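(* The Newton complementary dual of a plane de Jonqui\`eres map $\mathfrak{F}$ is a plane de Jonqui\`eres map. More exactly, let $\mathfrak{F}$ be a plane de Jonqui\`eres map defined by nonzero forms $\mathbf{f}=\{xq,yq,f\}\subset k[x,y,z]$ of degree $d$, where $q=g+zh$ with $g,h\in k[x,y]$ forms of degrees $d-1$, $d-2$ respectively, and $f=f_0+zf_1$ with $f_0,f_1\in k[x,y]$ forms of degrees $d$, $d-1$ respectively. Then the linear system spanned by the Newton complementary dual $\widehat{\mathbf{f}}$ defines a plane de Jonqui\`eres map of degree $$\hat d:=\max\{j_g+1,\,j_h+1,\,j_{f_0},\,j_{f_1}\}-\min\{i_g,\,i_h+1,\,i_{f_0},\,i_{f_1}+1\}+1,$$ where $i_g$ (respectively $j_g$), with $0\le i_g,j_g\le d-1$, is the first (respectively last) index $i$ such that the term of $g$ of order $(d-1-i,i)$ (i.e. the term in $x^{d-1-i}y^{i}$) does not vanish, and $\{i_h,j_h\}$, $\{i_{f_0},j_{f_0}\}$, $\{i_{f_1},j_{f_1}\}$ are defined similarly for the forms $h$, $f_0$, $f_1$, respectively (i.e. the smallest and largest exponents of $y$ among the nonzero terms of the form).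
   Context: $k$ is an infinite field (taken to be algebraically closed for geometric purposes). A $z$-monoid is a polynomial of the shape $p_0+zp_1$ with $p_0,p_1$ forms in $k[x,y]$ (with $p_0+zp_1$ homogeneous). A plane de Jonqui\`eres map is a Cremona map of $\mathbb{P}^2$ whose linear system can be spanned by three forms of the same degree in $k[x,y,z]$ of the shape $xq,\,yq,\,f$, where $q$ and $f$ are $z$-monoids and $f$ is irreducible. Its degree is the common degree of these forms. All sets of forms $\mathbf{f}$ considered satisfy the canonical restrictions: their gcd is $1$ and every variable appears effectively in at least one of them. If one of the forms $g,h,f_0,f_1$ is zero, its indices are omitted from the max and min. Newton complementary dual: for a set $\mathbf{f}=\{F_0,F_1,F_2\}$ of forms of the same degree in $k[x_0,x_1,x_2]=k[x,y,z]$, write $F_j=\sum_{\ell}c_{j,\ell}\,\mathbf{x}^{a_{j,\ell}}$ as the sum of its nonzero terms. Let $\alpha_i$ be the maximum exponent of $x_i$ over all nonzero terms of all the forms $F_0,F_1,F_2$, and $\underline\alpha=(\alpha_0,\alpha_1,\alpha_2)$. Then $\widehat{F_j}:=\sum_{\ell}c_{j,\ell}\,\mathbf{x}^{\underline\alpha-a_{j,\ell}}$ and $\widehat{\mathbf{f}}=\{\widehat{F_0},\widehat{F_1},\widehat{F_2}\}$. The Newton complementary dual of the map defined by $\mathbf{f}$ is the map defined by $\widehat{\mathbf{f}}$. *)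

theory Defs
  imports
    "HOL-Library.Poly_Mapping"
    "HOL-Library.Numeral_Type"
    "HOL-Computational_Algebra.Factorial_Ring"
begin

text \<open>
  The ring $k[x,y,z] = k[x_0,x_1,x_2]$ is rendered as finitely supported functions from
  exponent vectors to coefficients; its variables are indexed by the three-element
  type \<open>3\<close>, with elements \<open>0, 1, 2\<close> standing for $x, y, z$.
\<close>

type_synonym 'k pol3 = "(3 \<Rightarrow>\<^sub>0 nat) \<Rightarrow>\<^sub>0 'k"

definition var :: "3 \<Rightarrow> 'k::field pol3" where
  "var i = Poly_Mapping.single (Poly_Mapping.single i 1) 1"

definition const :: "'k::field \<Rightarrow> 'k pol3" where
  "const c = Poly_Mapping.single 0 c"

definition mdeg :: "(3 \<Rightarrow>\<^sub>0 nat) \<Rightarrow> nat" where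
  "mdeg m = (\<Sum>i\<in>UNIV. Poly_Mapping.lookup m i)"

text \<open>
  Degrees of forms are integers, so that a form of degree \<open>d - 2\<close> or \<open>d - 1\<close> makes sense for
  every \<open>d\<close>: the zero polynomial is a form of every degree, and it is the only form of negative
  degree.
\<close>

definition form :: "int \<Rightarrow> 'k::field pol3 \<Rightarrow> bool" where
  "form n p \<longleftrightarrow> (\<forall>m\<in>Poly_Mapping.keys p. int (mdeg m) = n)"

definition form_xy :: "int \<Rightarrow> 'k::field pol3 \<Rightarrow> bool" where
  "form_xy n p \<longleftrightarrow> form n p \<and> (\<forall>m\<in>Poly_Mapping.keys p. Poly_Mapping.lookup m 2 = 0)"

definition z_monoid :: "int \<Rightarrow> 'k::field pol3 \<Rightarrow> bool" where
  "z_monoid n p \<longleftrightarrow> (\<exists>p0 p1. form_xy n p0 \<and> form_xy (n - 1) p1 \<and> p = p0 + var 2 * p1)"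

definition triple :: "'a \<Rightarrow> 'a \<Rightarrow> 'a \<Rightarrow> 3 \<Rightarrow> 'a" where
  "triple a b c = (\<lambda>i. if i = 0 then a else if i = 1 then b else c)"

definition subst :: "(3 \<Rightarrow> 'k::field pol3) \<Rightarrow> 'k pol3 \<Rightarrow> 'k pol3" where
  "subst F p =
     (\<Sum>m\<in>Poly_Mapping.keys p.
        const (Poly_Mapping.lookup p m) * (\<Prod>i\<in>UNIV. F i ^ Poly_Mapping.lookup m i))"

text \<open>
  The rational map of the projective plane given by three forms \<open>F\<close> of the same degree is
  birational: some \<open>G\<close> is inverse to it on both sides. The composite of two rational maps is the
  identity if the substituted forms are a common nonzero multiple of $(x:y:z)$; the
  nonvanishing of this multiple also ensures that the composite is defined.
\<close>

definition cremona :: "(3 \<Rightarrow> 'k::field pol3) \<Rightarrow> bool" where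
  "cremona F \<longleftrightarrow>
     (\<exists>n. \<forall>i. form n (F i)) \<and>
     (\<exists>G e p p'. (\<forall>i. form e (G i)) \<and> p \<noteq> 0 \<and> p' \<noteq> 0 \<and>
        (\<forall>i. subst F (G i) = var i * p) \<and> (\<forall>i. subst G (F i) = var i * p'))"

definition linear_system :: "(3 \<Rightarrow> 'k::field pol3) \<Rightarrow> 'k pol3 set" where
  "linear_system F = {\<Sum>i\<in>UNIV. const (c i) * F i | c. True}"

definition canonical_restrictions :: "(3 \<Rightarrow> 'k::field pol3) \<Rightarrow> bool" where
  "canonical_restrictions F \<longleftrightarrow>
     (\<forall>p. (\<forall>i. p dvd F i) \<longrightarrow> p dvd 1) \<and>
     (\<forall>i. \<exists>j. \<exists>m\<in>Poly_Mapping.keys (F j). Poly_Mapping.lookup m i \<noteq> 0)"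

text \<open>
  The source coordinates are fixed; the forms \<open>F\<close> themselves need not have the
  shape $xq, yq, f$, but they span the same linear system as three such forms.
\<close>

definition de_jonquieres :: "int \<Rightarrow> (3 \<Rightarrow> 'k::field pol3) \<Rightarrow> bool" where
  "de_jonquieres d F \<longleftrightarrow>
     canonical_restrictions F \<and> cremona F \<and> (\<forall>i. form d (F i)) \<and>
     (\<exists>q f. z_monoid (d - 1) q \<and> z_monoid d f \<and> irreducible f \<and>
        linear_system F = linear_system (triple (var 0 * q) (var 1 * q) f))"

definition max_exponents :: "(3 \<Rightarrow> 'k::field pol3) \<Rightarrow> (3 \<Rightarrow>\<^sub>0 nat)" where
  "max_exponents F =
     (\<Sum>i\<in>UNIV. Poly_Mapping.single i
        (Max ((\<lambda>m. Poly_Mapping.lookup m i) ` (\<Union>j. Poly_Mapping.keys (F j)))))"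

text \<open>
  The truncated subtraction of exponent vectors below is exact: every exponent of the forms
  is bounded by \<open>max_exponents F\<close>.
\<close>

definition newton_dual :: "(3 \<Rightarrow> 'k::field pol3) \<Rightarrow> 3 \<Rightarrow> 'k pol3" where
  "newton_dual F j =
     (\<Sum>m\<in>Poly_Mapping.keys (F j).
        Poly_Mapping.single (max_exponents F - m) (Poly_Mapping.lookup (F j) m))"

text \<open>
  First and last index of a nonzero form in \<open>x, y\<close>, i.e. its least and greatest exponent of \<open>y\<close>.
\<close>

definition first_index :: "'k::field pol3 \<Rightarrow> int" where
  "first_index p = Min ((\<lambda>m. int (Poly_Mapping.lookup m 1)) ` Poly_Mapping.keys p)"

definition last_index :: "'k::field pol3 \<Rightarrow> int" where
  "last_index p = Max ((\<lambda>m. int (Poly_Mapping.lookup m 1)) ` Poly_Mapping.keys p)"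

end

theory Submission
  imports Defs "HOL-Computational_Algebra.Polynomial_Factorial"
begin

text \<open>
  Write $q = g + zh$ and $f = f_0 + z f_1$. For fixed $(x:y)$, the map $(xq : yq : f)$ acts on
  $z$ by the fractional linear map $f/q$ with coefficients in $k(x,y)$, so everything is
  governed by the determinant $\Delta = g f_1 - f_0 h$. If $\Delta \neq 0$ the map is
  birational, with the inverse of the adjugate matrix, which is again of the same shape
  (\<open>cremona_if_determinant\<close>). If $\Delta = 0$, then $f/q$ does not involve $z$,
  and $z$ cannot be recovered (\<open>determinant_if_cremona\<close>).

  Let $\alpha$ be the vector of maximal exponents. The exponent of $z$ in it is 1, and the
  dual is $(y \hat q : x \hat q : \hat f)$, where $\hat q$ and $\hat f$ are again $z$-monoids:
  complementing exchanges the two coefficients of the powers of $z$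
  (\<open>newton_dual_eq\<close>). With $t = y/x$ on the original side and $t = x/y$ on the
  dual side, the four coefficient forms of the dual are, up to a common power of $t$, those of
  the original, with an additional factor $t$ at $h$ and $f_1$ (\<open>dual_charts\<close>).
  Hence the determinant of the dual is nonzero. A common factor of its coefficients other than
  $t$ would be a common factor of the original coefficients, after homogenization. The
  variables $x$ and $y$ are no common factors of the dual, because the maximal exponents are
  attained.

  What can fail is the irreducibility of $\hat f$: it may be divisible by $x$ or $y$, for
  instance. But the linear system also contains $\hat f + (cx + ay) \hat q$ for all $a, c$. In
  the chart $y = 1$ such a form is linear in $z$, and it is irreducible once its two
  coefficients are coprime. A common prime divisor of them divides the determinant, and the
  absence of a fixed component forces distinct $a$ to have distinct such primes
  (\<open>dvd_pencil_eq\<close>). So only finitely many $a$ are bad, and an infinite field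
  contains a good one (\<open>coprime_pencil_member\<close>). The coefficient $c$ is chosen so
  that $y$, which the chart does not see, is not a factor. The criterion
  \<open>de_jonquieres_criterion\<close> collects this.

  The degree of the dual is $\alpha_x + \alpha_y + 1 - d$. The maximum in the theorem is
  $\alpha_y$ (\<open>last_index_max\<close>). A form in $x, y$ has the least exponent of $y$
  where the exponent of $x$ is greatest, so the minimum is $d - \alpha_x$
  (\<open>first_index_min\<close>).
\<close>

section \<open>Polynomials in three variables\<close>

abbreviation "lookup \<equiv> Poly_Mapping.lookup"
abbreviation "keys \<equiv> Poly_Mapping.keys"
abbreviation "single \<equiv> Poly_Mapping.single"

lemma UNIV_3: "(UNIV :: 3 set) = {0, 1, 2}"
proof -
  have "card {0, 1, 2 :: 3} = CARD(3)"
    by simp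
  then show ?thesis
    by (metis card_subset_eq finite_class.finite_UNIV subset_UNIV)
qed

lemma exhaust_3: obtains "i = (0 :: 3)" | "i = 1" | "i = 2"
  using UNIV_3 by (metis UNIV_I insertE singletonD)

lemma all_3: "(\<forall>i :: 3. P i) \<longleftrightarrow> P 0 \<and> P 1 \<and> P 2"
  by (metis exhaust_3)

lemma sum_3: "(\<Sum>i\<in>UNIV. f (i :: 3)) = f 0 + f 1 + f 2"
  unfolding UNIV_3 by (simp add: add.assoc)

lemma prod_3: "(\<Prod>i\<in>UNIV. f (i :: 3)) = f 0 * f 1 * f 2"
  unfolding UNIV_3 by (simp add: mult.assoc)

lemma triple_simps [simp]: "triple a b c 0 = a" "triple a b c 1 = b" "triple a b c 2 = c"
  by (simp_all add: triple_def)

lemma exponent_eqI: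
  fixes m m' :: "3 \<Rightarrow>\<^sub>0 nat"
  assumes "lookup m 0 = lookup m' 0" "lookup m 1 = lookup m' 1" "lookup m 2 = lookup m' 2"
  shows "m = m'"
  by (rule poly_mapping_eqI) (metis assms exhaust_3)

lemma mdeg_3: "mdeg m = lookup m 0 + lookup m 1 + lookup m 2"
  by (simp add: mdeg_def sum_3)

lemma mdeg_add [simp]: "mdeg (m + n) = mdeg m + mdeg n"
  by (simp add: mdeg_3 lookup_add)

lemma poly_mapping_sum_single:
  fixes p :: "'a \<Rightarrow>\<^sub>0 'b::comm_monoid_add"
  shows "(\<Sum>m\<in>keys p. single m (lookup p m)) = p"
  by (rule poly_mapping_eqI)
     (simp add: lookup_sum lookup_single when_def in_keys_iff)

lemma pol3_induct [case_names single add]: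
  fixes p :: "'a \<Rightarrow>\<^sub>0 'b::comm_monoid_add"
  assumes "\<And>m a. P (single m a)"
    and "\<And>p q. P p \<Longrightarrow> P q \<Longrightarrow> P (p + q)"
  shows "P p"
proof -
  have "P (\<Sum>m\<in>S. single m (lookup p m))" if "finite S" for S
    using that
  proof induction
    case empty
    then show ?case using assms(1)[of undefined 0] by simp
  qed (simp add: assms)
  then show ?thesis
    using poly_mapping_sum_single[of p] by (metis finite_keys)
qed

section \<open>Evaluation homomorphisms\<close>

text \<open>
  Substitutions, affine charts and the grading by degree are all ring homomorphisms out of the
  polynomial ring. They are treated as instances of one evaluation map, given by the image of
  the coefficients and the images of the variables.
\<close>

definition peval :: "('k::field \<Rightarrow> 'r::comm_ring_1) \<Rightarrow> (3 \<Rightarrow> 'r) \<Rightarrow> 'k pol3 \<Rightarrow> 'r" where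
  "peval c F p = (\<Sum>m\<in>keys p. c (lookup p m) * (\<Prod>i\<in>UNIV. F i ^ lookup m i))"

locale coefficient_hom =
  fixes c :: "'k::field \<Rightarrow> 'r::comm_ring_1"
  assumes hom_add: "c (a + b) = c a + c b"
    and hom_mult: "c (a * b) = c a * c b"
    and hom_one: "c 1 = 1"
begin

lemma hom_zero: "c 0 = 0"
  using hom_add[of 0 0] by simp

lemma peval_eq_sum:
  assumes "finite S" "keys p \<subseteq> S"
  shows "peval c F p = (\<Sum>m\<in>S. c (lookup p m) * (\<Prod>i\<in>UNIV. F i ^ lookup m i))"
  unfolding peval_def
  by (rule sum.mono_neutral_left) (use assms in \<open>auto simp: in_keys_iff hom_zero\<close>)

lemma peval_single: "peval c F (single m a) = c a * (\<Prod>i\<in>UNIV. F i ^ lookup m i)"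
  using peval_eq_sum[of "{m}" "single m a" F] by (simp add: hom_zero)

lemma peval_add: "peval c F (p + q) = peval c F p + peval c F q"
proof -
  let ?S = "keys p \<union> keys q"
  have "keys (p + q) \<subseteq> ?S"
    by (rule Poly_Mapping.keys_add)
  then show ?thesis
    by (simp add: peval_eq_sum[of ?S] lookup_add hom_add algebra_simps sum.distrib)
qed

lemma peval_zero [simp]: "peval c F 0 = 0"
  by (simp add: peval_def)

lemma peval_uminus: "peval c F (- p) = - peval c F p"
  using peval_add[of F p "- p"] by (simp add: eq_neg_iff_add_eq_0 add.commute)

lemma peval_diff: "peval c F (p - q) = peval c F p - peval c F q"
  using peval_add[of F p "- q"] by (simp add: peval_uminus)

lemma peval_mult: "peval c F (p * q) = peval c F p * peval c F q"
proof (induction p rule: pol3_induct)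
  case (single m a)
  show ?case
  proof (induction q rule: pol3_induct)
    case (single n b)
    show ?case
      by (simp add: mult_single peval_single lookup_add power_add prod.distrib hom_mult
          algebra_simps)
  qed (simp add: peval_add algebra_simps)
qed (simp add: peval_add algebra_simps)

lemma peval_one: "peval c F 1 = 1"
  using peval_single[of F 0 1] by (simp add: hom_one)

lemma peval_power: "peval c F (p ^ n) = peval c F p ^ n"
  by (induction n) (simp_all add: peval_one peval_mult)

lemma peval_sum: "peval c F (sum p A) = (\<Sum>a\<in>A. peval c F (p a))"
  by (induction A rule: infinite_finite_induct) (simp_all add: peval_add)

lemma peval_const [simp]: "peval c F (const a) = c a"
  by (simp add: const_def peval_single)

lemma peval_var [simp]: "peval c F (var i) = F i"
proof -
  have "(\<Prod>j\<in>UNIV. F j ^ lookup (single i (1::nat)) j)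
      = (\<Prod>j\<in>UNIV. if j = i then F j else 1)"
    by (rule prod.cong) (auto simp: lookup_single when_def)
  then show ?thesis
    by (simp add: var_def peval_single hom_one)
qed

lemmas peval_hom = peval_add peval_uminus peval_diff peval_mult peval_one peval_power

end

lemma const_hom: "coefficient_hom (const :: 'k::field \<Rightarrow> 'k pol3)"
  by unfold_locales (simp_all add: const_def single_add mult_single)

interpretation const: coefficient_hom "const :: 'k::field \<Rightarrow> 'k pol3"
  by (rule const_hom)

lemma subst_eq_peval: "subst F = peval const F"
  by (simp add: fun_eq_iff subst_def peval_def)

lemmas subst_hom = const.peval_hom[folded subst_eq_peval]
lemmas subst_const [simp] = const.peval_const[folded subst_eq_peval]
lemmas subst_var [simp] = const.peval_var[folded subst_eq_peval]
lemmas subst_zero [simp] = const.peval_zero[folded subst_eq_peval]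

lemma hom_prod:
  assumes "\<And>p q. \<phi> (p * q) = \<phi> p * \<phi> q" "\<phi> (1::'a::comm_monoid_mult) = (1::'b::comm_monoid_mult)"
  shows "\<phi> (prod f A) = (\<Prod>a\<in>A. \<phi> (f a))"
  by (induction A rule: infinite_finite_induct) (simp_all add: assms)

lemma hom_power:
  assumes "\<And>p q. \<phi> (p * q) = \<phi> p * \<phi> q" "\<phi> (1::'a::comm_monoid_mult) = (1::'b::comm_monoid_mult)"
  shows "\<phi> (a ^ n) = \<phi> a ^ n"
  by (induction n) (simp_all add: assms)

text \<open>
  This is why composites of substitutions, and of substitutions with charts, can be computed
  on the variables.
\<close>

lemma hom_peval:
  fixes \<phi> :: "'r::comm_ring_1 \<Rightarrow> 's::comm_ring_1"
  assumes "\<And>a b. \<phi> (a + b) = \<phi> a + \<phi> b" "\<And>a b. \<phi> (a * b) = \<phi> a * \<phi> b" "\<phi> 1 = 1"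
  shows "\<phi> (peval c F p) = peval (\<lambda>a. \<phi> (c a)) (\<lambda>i. \<phi> (F i)) p"
proof -
  have "\<phi> 0 = 0"
    using assms(1)[of 0 0] by simp
  then have "\<phi> (sum f A) = (\<Sum>a\<in>A. \<phi> (f a))" for f and A :: "(3 \<Rightarrow>\<^sub>0 nat) set"
    by (induction A rule: infinite_finite_induct) (simp_all add: assms)
  then show ?thesis
    unfolding peval_def
    by (simp add: assms(2) hom_prod[of \<phi>, OF assms(2,3)] hom_power[of \<phi>, OF assms(2,3)])
qed

lemma subst_subst: "subst F (subst G p) = subst (\<lambda>i. subst F (G i)) p"
  unfolding subst_eq_peval
  by (subst hom_peval) (simp_all add: const.peval_hom)

lemma subst_var_id [simp]: "subst var p = p"
proof (induction p rule: pol3_induct)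
  case (single m a)
  have "(\<Prod>i\<in>UNIV. var i ^ lookup m i) = single m (1::'a)"
  proof -
    have pow: "(var i :: 'a pol3) ^ n = single (single i n) 1" for i n
      by (induction n) (simp_all add: var_def mult_single flip: single_add)
    have "single 0 (lookup m 0) + single 1 (lookup m 1)
        + single 2 (lookup m 2) = m"
      by (rule exponent_eqI) (simp_all add: lookup_add lookup_single)
    then show ?thesis
      by (simp add: prod_3 pow mult_single)
  qed
  then show ?case
    by (simp add: subst_eq_peval const.peval_single) (simp add: const_def mult_single)
qed (simp add: subst_hom)

section \<open>Forms and expansions in the third variable\<close>

definition z_free :: "'k::field pol3 \<Rightarrow> bool" where
  "z_free p \<longleftrightarrow> (\<forall>m\<in>keys p. lookup m 2 = 0)"

lemma form_xy_iff: "form_xy n p \<longleftrightarrow> form n p \<and> z_free p"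
  by (simp add: form_xy_def z_free_def)

lemma peval_z_free_cong:
  assumes "z_free p" "F 0 = G 0" "F 1 = G 1"
  shows "peval c F p = peval c G p"
  unfolding peval_def
  by (rule sum.cong) (use assms in \<open>auto simp: z_free_def prod_3\<close>)

lemma peval_scale:
  assumes "form (int n) p"
  shows "peval c (\<lambda>i. r * F i) p = r ^ n * peval c F p"
proof -
  have "c (lookup p m) * (\<Prod>i\<in>UNIV. (r * F i) ^ lookup m i)
      = r ^ n * (c (lookup p m) * (\<Prod>i\<in>UNIV. F i ^ lookup m i))" if "m \<in> keys p" for m
  proof -
    have "n = lookup m 0 + lookup m 1 + lookup m 2"
      using assms that by (auto simp: form_def mdeg_3)
    then show ?thesis
      by (simp add: prod_3 power_mult_distrib power_add algebra_simps)
  qed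
  then show ?thesis
    unfolding peval_def by (simp add: sum_distrib_left)
qed

lemma form_zero [simp]: "form n 0"
  by (simp add: form_def)

lemma form_add: "form n p \<Longrightarrow> form n q \<Longrightarrow> form n (p + q)"
  using Poly_Mapping.keys_add[of p q] by (auto simp: form_def)

lemma form_uminus: "form n p \<Longrightarrow> form n (- p)"
  by (auto simp: form_def in_keys_iff lookup_uminus)

lemma form_diff: "form n p \<Longrightarrow> form n q \<Longrightarrow> form n (p - q)"
  using form_add[of n p "- q"] form_uminus[of n q] by simp

lemma form_mult: "form a p \<Longrightarrow> form b q \<Longrightarrow> form (a + b) (p * q)"
  using keys_mult[of p q] by (fastforce simp: form_def)

lemma form_const [simp]: "form 0 (const a)"
  by (auto simp: form_def const_def mdeg_3)

lemma form_var [simp]: "form 1 (var i)"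
  by (auto simp: form_def var_def mdeg_def lookup_single when_def)

lemma z_free_zero [simp]: "z_free 0"
  by (simp add: z_free_def)

lemma z_free_add: "z_free p \<Longrightarrow> z_free q \<Longrightarrow> z_free (p + q)"
  using Poly_Mapping.keys_add[of p q] by (auto simp: z_free_def)

lemma z_free_uminus: "z_free p \<Longrightarrow> z_free (- p)"
  by (auto simp: z_free_def in_keys_iff lookup_uminus)

lemma z_free_diff: "z_free p \<Longrightarrow> z_free q \<Longrightarrow> z_free (p - q)"
  using z_free_add[of p "- q"] z_free_uminus[of q] by simp

lemma z_free_mult: "z_free p \<Longrightarrow> z_free q \<Longrightarrow> z_free (p * q)"
  using keys_mult[of p q] by (fastforce simp: z_free_def lookup_add)

lemma form_xy_add: "form_xy n p \<Longrightarrow> form_xy n q \<Longrightarrow> form_xy n (p + q)"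
  by (simp add: form_xy_iff form_add z_free_add)

lemma form_xy_diff: "form_xy n p \<Longrightarrow> form_xy n q \<Longrightarrow> form_xy n (p - q)"
  by (simp add: form_xy_iff form_diff z_free_diff)

lemma form_xy_mult: "form_xy a p \<Longrightarrow> form_xy b q \<Longrightarrow> form_xy (a + b) (p * q)"
  by (simp add: form_xy_iff form_mult z_free_mult)

lemma z_free_const [simp]: "z_free (const a)"
  by (auto simp: z_free_def const_def)

lemma z_free_var [simp]: "z_free (var 0)" "z_free (var 1)"
  by (auto simp: z_free_def var_def lookup_single when_def)

lemma var_nonzero [simp]: "var i \<noteq> 0"
  by (metis var_def lookup_single_eq lookup_zero one_neq_zero)

lemma subst_z_free:
  assumes "z_free p" shows "subst (triple (var 0) (var 1) a) p = p"
proof -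
  have "subst (triple (var 0) (var 1) a) p = subst var p"
    unfolding subst_eq_peval by (rule peval_z_free_cong[OF assms]) simp_all
  then show ?thesis
    by simp
qed

lemma form_power: "form a p \<Longrightarrow> form (int n * a) (p ^ n)"
proof (induction n)
  case (Suc n)
  then show ?case
    using form_mult[of a p "int n * a" "p ^ n"] by (simp add: algebra_simps)
qed (use form_const[of 1] in \<open>simp add: const_def\<close>)

lemma form_sum: "(\<And>x. x \<in> A \<Longrightarrow> form n (p x)) \<Longrightarrow> form n (sum p A)"
  by (induction A rule: infinite_finite_induct) (simp_all add: form_add)

lemma z_free_sum: "(\<And>x. x \<in> A \<Longrightarrow> z_free (p x)) \<Longrightarrow> z_free (sum p A)"
  by (induction A rule: infinite_finite_induct) (simp_all add: z_free_add)

lemma z_free_power: "z_free p \<Longrightarrow> z_free (p ^ n)"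
  by (induction n) (use z_free_const[of 1] in \<open>auto simp: const_def intro: z_free_mult\<close>)

lemma form_z_expansion:
  assumes "form_xy n a" "form_xy (n - 1) b"
  shows "form n (a + var 2 * b)"
  using form_mult[OF form_var, of "n - 1" b 2] assms by (simp add: form_xy_iff form_add)

lemma form_negative: "form n p \<Longrightarrow> n < 0 \<Longrightarrow> p = 0"
  by (rule ccontr) (use keys_eq_empty in \<open>force simp: form_def\<close>)

lemma subst_z_0: "subst (triple (var 0) (var 1) 0) (a + var 2 * b) = a"
  if "z_free a" for a b :: "'k::field pol3"
  using that by (simp add: subst_hom subst_z_free)

text \<open>
  Setting $z = 0$ isolates the first coefficient of an expansion in $z$.
\<close>

lemma z_expansion_eq_0:
  fixes a b :: "'k::field pol3"
  assumes "z_free a" "a + var 2 * b = 0"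
  shows "a = 0 \<and> b = 0"
proof -
  have "a = 0"
    using subst_z_0[OF assms(1), of b] assms(2) by simp
  then show ?thesis
    using assms(2) by simp
qed

lemma single_times_eq_sum:
  fixes p :: "'k::field pol3"
  shows "single a 1 * p = (\<Sum>m\<in>keys p. single (a + m) (lookup p m))"
proof -
  have "single a 1 * p = single a 1 * (\<Sum>m\<in>keys p. single m (lookup p m))"
    by (simp add: poly_mapping_sum_single)
  also have "\<dots> = (\<Sum>m\<in>keys p. single (a + m) (lookup p m))"
    by (simp add: sum_distrib_left mult_single)
  finally show ?thesis .
qed

lemma keys_single_times:
  fixes p :: "'k::field pol3"
  shows "keys (single a 1 * p) = (+) a ` keys p"
proof -
  have "lookup (single a 1 * p) n = (if n \<in> (+) a ` keys p then lookup p (n - a) else 0)" for n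
  proof -
    have "lookup (single a 1 * p) n = (\<Sum>m\<in>keys p. if n = a + m then lookup p m else 0)"
      by (simp add: single_times_eq_sum lookup_sum lookup_single when_def eq_commute)
    also have "\<dots> = (if n \<in> (+) a ` keys p then lookup p (n - a) else 0)"
    proof (cases "n \<in> (+) a ` keys p")
      case True
      then obtain m where "m \<in> keys p" "n = a + m"
        by blast
      then show ?thesis
        by (auto simp: sum.delta')
    next
      case False
      then have "\<forall>m\<in>keys p. (if n = a + m then lookup p m else 0) = 0"
        by auto
      then show ?thesis
        using False by (simp only: sum.neutral if_False)
    qed
    finally show ?thesis .
  qed
  then show ?thesis
    by (auto simp: in_keys_iff split: if_splits)
qed

lemma keys_var_times: "keys (var i * p) = (+) (single i 1) ` keys p"
  by (simp add: var_def keys_single_times)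

text \<open>
  No cancellation is possible between the two summands, since the exponents of $z$ differ.
\<close>

lemma keys_z_expansion:
  fixes a b :: "'k::field pol3"
  assumes "z_free a"
  shows "keys (a + var 2 * b) = keys a \<union> (+) (single 2 1) ` keys b"
proof -
  have "lookup m 2 = 0" if "m \<in> keys a" for m
    using that assms by (simp add: z_free_def)
  moreover have "lookup m 2 \<noteq> 0" if "m \<in> keys (var 2 * b)" for m
    using that by (auto simp: keys_var_times lookup_add)
  ultimately have "keys a \<inter> keys (var 2 * b) = {}"
    by blast
  then have "lookup a m = 0 \<or> lookup (var 2 * b) m = 0" for m
    by (auto simp: in_keys_iff)
  then have "m \<in> keys (a + var 2 * b) \<longleftrightarrow> m \<in> keys a \<or> m \<in> keys (var 2 * b)" for m
    by (metis add_cancel_left_left add_cancel_left_right in_keys_iff lookup_add)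
  then have "keys (a + var 2 * b) = keys a \<union> keys (var 2 * b)"
    by blast
  then show ?thesis
    by (simp add: keys_var_times)
qed

lemma var_times_var: "var i * var j = single (single i 1 + single j 1) 1"
  by (simp add: var_def mult_single)

section \<open>Birationality of a map of de Jonquieres shape\<close>

text \<open>
  A form in $x, y$ only sees the first two components, so a common factor of these comes out
  with the degree as exponent.
\<close>

lemma subst_scaled:
  assumes "form_xy (int n) p"
  shows "subst (triple (var 0 * t) (var 1 * t) s) p = t ^ n * p"
proof -
  have "subst (triple (var 0 * t) (var 1 * t) s) p = subst (\<lambda>i. t * var i) p"
    unfolding subst_eq_peval
    by (rule peval_z_free_cong) (use assms in \<open>simp_all add: form_xy_iff mult.commute\<close>)
  also have "\<dots> = t ^ n * p"
    using peval_scale[of n p const t var] assms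
    by (metis form_xy_iff subst_eq_peval subst_var_id)
  finally show ?thesis .
qed

text \<open>
  Solving $w = f/q$ for $z$ gives $z = (wg - f_0)/(f_1 - wh)$. Clearing denominators and
  writing $z$ for $w$, the inverse is $(xt : yt : s)$ with $t = f_1 - zh$ and $s = zg - f_0$.
  Both composites are checked through the identities of the adjugate matrix: $tg + sh =
  \Delta$ and $t f_0 + s f_1 = z \Delta$ for one, $q f_1 - f h = \Delta$ and $f g - q f_0 = z
  \Delta$ for the other.
\<close>

lemma cremona_if_determinant:
  fixes g h f0 f1 :: "'k::field pol3"
  assumes d: "d \<ge> 1"
    and g: "form_xy (d - 1) g" and h: "form_xy (d - 2) h"
    and f0: "form_xy d f0" and f1: "form_xy (d - 1) f1"
    and D: "g * f1 \<noteq> f0 * h"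
  shows "cremona (triple (var 0 * (g + var 2 * h)) (var 1 * (g + var 2 * h)) (f0 + var 2 * f1))"
proof -
  define q f where "q = g + var 2 * h" and "f = f0 + var 2 * f1"
  define t s where "t = f1 - var 2 * h" and "s = var 2 * g - f0"
  define \<Delta> where "\<Delta> = g * f1 - f0 * h"
  define n where "n = nat (d - 1)"
  have "\<Delta> \<noteq> 0"
    using D by (simp add: \<Delta>_def)
  have n: "int n = d - 1" "int (Suc n) = d"
    using d by (simp_all add: n_def)
  have tg: "t * g + s * h = \<Delta>" and tf: "t * f0 + s * f1 = var 2 * \<Delta>"
    by (simp_all add: t_def s_def \<Delta>_def algebra_simps)
  have qf: "q * f1 - f * h = \<Delta>" and fq: "f * g - q * f0 = var 2 * \<Delta>"
    by (simp_all add: q_def f_def \<Delta>_def algebra_simps)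
  have zf: "z_free g" "z_free h" "z_free f0" "z_free f1"
    using assms by (simp_all add: form_xy_iff)
  have "q \<noteq> 0"
    using z_expansion_eq_0[of g h] zf \<open>\<Delta> \<noteq> 0\<close> by (auto simp: q_def \<Delta>_def)
  have "t \<noteq> 0"
    using z_expansion_eq_0[of f1 "- h"] zf \<open>\<Delta> \<noteq> 0\<close> by (auto simp: t_def \<Delta>_def)
  let ?F = "triple (var 0 * q) (var 1 * q) f" and ?G = "triple (var 0 * t) (var 1 * t) s"
  \<comment> \<open>The additional factor makes this valid for $d = 1$ as well, where $h$ has negative degree.\<close>
  have shift: "subst (triple (var 0 * a) (var 1 * a) b) h * a = a ^ n * h" for a b
  proof (cases n)
    case 0
    then have "h = 0"
      using form_negative[of "d - 2" h] h n by (simp add: form_xy_iff)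
    then show ?thesis by simp
  next
    case (Suc k)
    then have "d - 2 = int k"
      using n by simp
    then have "form_xy (int k) h"
      using h by simp
    then show ?thesis
      using Suc by (simp add: subst_scaled)
  qed
  have g': "form_xy (int n) g" and f0': "form_xy (int (Suc n)) f0" and f1': "form_xy (int n) f1"
    unfolding n by (fact g f0 f1)+
  have form_h: "form (d - 1) (var 2 * h)" and form_f1: "form d (var 2 * f1)"
    and form_g: "form d (var 2 * g)"
    using form_mult[OF form_var, of "d - 2" h 2] form_mult[OF form_var, of "d - 1" f1 2]
      form_mult[OF form_var, of "d - 1" g 2] h f1 g by (simp_all add: form_xy_iff)
  have forms: "form (d - 1) q" "form d f" "form (d - 1) t" "form d s"
    unfolding q_def f_def t_def s_def
    using form_h form_f1 form_g g f0 f1 by (auto intro: form_add form_diff simp: form_xy_iff)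
  have vforms: "form d (var i * q)" "form d (var i * t)" for i
    using form_mult[OF form_var forms(1), of i] form_mult[OF form_var forms(3), of i] by simp_all
  have G_q: "subst ?G q = t ^ n * g + s * subst ?G h"
    by (simp add: q_def subst_hom subst_scaled[OF g'])
  have "t * subst ?G q = t ^ n * (t * g) + s * (subst ?G h * t)"
    unfolding G_q by (simp add: algebra_simps)
  also have "\<dots> = t ^ n * (t * g + s * h)"
    unfolding shift by (simp add: algebra_simps)
  finally have Gq: "t * subst ?G q = t ^ n * \<Delta>"
    unfolding tg .
  have G_f: "subst ?G f = t ^ Suc n * f0 + s * (t ^ n * f1)"
    by (simp add: f_def subst_hom subst_scaled[OF f0'] subst_scaled[OF f1'])
  have "subst ?G f = t ^ n * (t * f0 + s * f1)"
    unfolding G_f by (simp add: algebra_simps)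
  then have Gf: "subst ?G f = var 2 * (t ^ n * \<Delta>)"
    unfolding tf by (simp add: algebra_simps)
  have F_t: "subst ?F t = q ^ n * f1 - f * subst ?F h"
    by (simp add: t_def subst_hom subst_scaled[OF f1'])
  have "q * subst ?F t = q ^ n * (q * f1) - f * (subst ?F h * q)"
    unfolding F_t by (simp add: algebra_simps)
  also have "\<dots> = q ^ n * (q * f1 - f * h)"
    unfolding shift by (simp add: algebra_simps)
  finally have Ft: "q * subst ?F t = q ^ n * \<Delta>"
    unfolding qf .
  have F_s: "subst ?F s = f * (q ^ n * g) - q ^ Suc n * f0"
    by (simp add: s_def subst_hom subst_scaled[OF f0'] subst_scaled[OF g'])
  have "subst ?F s = q ^ n * (f * g - q * f0)"
    unfolding F_s by (simp add: algebra_simps)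
  then have Fs: "subst ?F s = var 2 * (q ^ n * \<Delta>)"
    unfolding fq by (simp add: algebra_simps)
  have "\<forall>i. form d (?F i)" "\<forall>i. form d (?G i)"
    using forms vforms by (simp_all add: all_3)
  moreover have "t ^ n * \<Delta> \<noteq> 0" "q ^ n * \<Delta> \<noteq> 0"
    using \<open>t \<noteq> 0\<close> \<open>q \<noteq> 0\<close> \<open>\<Delta> \<noteq> 0\<close> by simp_all
  moreover have "\<forall>i. subst ?F (?G i) = var i * (q ^ n * \<Delta>)"
    by (simp add: all_3 subst_hom Fs Ft mult.assoc)
  moreover have "\<forall>i. subst ?G (?F i) = var i * (t ^ n * \<Delta>)"
    by (simp add: all_3 subst_hom Gf Gq mult.assoc)
  ultimately show ?thesis
    unfolding cremona_def q_def[symmetric] f_def[symmetric] by blast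
qed

lemma z_free_subst:
  assumes "z_free (F 0)" "z_free (F 1)" "z_free (F 2)"
  shows "subst (triple (var 0) (var 1) 0) (subst F p) = subst F p"
proof -
  have "(\<lambda>i. subst (triple (var 0) (var 1) 0) (F i)) = F"
  proof
    show "subst (triple (var 0) (var 1) 0) (F i) = F i" for i
      by (rule exhaust_3[of i]) (use assms in \<open>simp_all add: subst_z_free\<close>)
  qed
  then show ?thesis
    by (simp add: subst_subst)
qed

text \<open>
  If the determinant vanishes, then $f/q = r'/r$ with $r, r'$ in $x, y$ only, so up to a
  common factor the map is $(xr : yr : r')$. Substituting it into an inverse $G$ gives forms
  free of $z$ which would be proportional to $(x : y : z)$.
\<close>

lemma determinant_if_cremona:
  fixes g h f0 f1 :: "'k::field pol3"
  assumes zf: "z_free g" "z_free h" "z_free f0" "z_free f1"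
    and q: "q = g + var 2 * h" "q \<noteq> 0" and f: "f = f0 + var 2 * f1"
    and "cremona (triple (var 0 * q) (var 1 * q) f)"
  shows "g * f1 \<noteq> f0 * h"
proof
  assume D: "g * f1 = f0 * h"
  let ?F = "triple (var 0 * q) (var 1 * q) f"
  let ?\<epsilon> = "subst (triple (var 0) (var 1) 0)"
  have "h * f = q * f1" "g * f = q * f0"
    using D by (simp_all add: q f algebra_simps)
  moreover have "g \<noteq> 0 \<or> h \<noteq> 0"
    using q by auto
  ultimately obtain r r' where r: "z_free r" "z_free r'" "r \<noteq> 0" "r * f = q * r'"
    using zf by blast
  let ?F' = "triple (var 0 * r) (var 1 * r) r'"
  have rF: "(\<lambda>i. r * ?F i) = (\<lambda>i. q * ?F' i)"
  proof
    show "r * ?F i = q * ?F' i" for i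
      by (rule exhaust_3[of i]) (use r(4) in \<open>simp_all add: mult_ac\<close>)
  qed
  from assms(8) obtain G e p where G: "\<And>i. form e (G i)" and "p \<noteq> 0"
    and FG: "\<And>i. subst ?F (G i) = var i * p"
    unfolding cremona_def by metis
  have "e \<ge> 0"
  proof (rule ccontr)
    assume "\<not> e \<ge> 0"
    then have "G 0 = 0"
      using form_negative[OF G] by simp
    then show False
      using FG[of 0] \<open>p \<noteq> 0\<close> by simp
  qed
  then obtain n where n: "e = int n"
    using nonneg_int_cases by blast
  define P where "P i = subst ?F' (G i)" for i
  have P: "r ^ n * (var i * p) = q ^ n * P i" for i
    using peval_scale[of n "G i" const r ?F] peval_scale[of n "G i" const q ?F'] G[of i] rF
    by (simp add: n P_def FG flip: subst_eq_peval)
  have \<epsilon>P: "?\<epsilon> (P i) = P i" for i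
    unfolding P_def by (rule z_free_subst) (use r in \<open>simp_all add: z_free_mult\<close>)
  have "q ^ n * (var 2 * P 0) = var 2 * (q ^ n * P 0)"
    by (simp only: mult_ac)
  also have "\<dots> = var 0 * (q ^ n * P 2)"
    unfolding P[symmetric] by (simp only: mult_ac)
  also have "\<dots> = q ^ n * (var 0 * P 2)"
    by (simp only: mult_ac)
  finally have "var 2 * P 0 = var 0 * P 2"
    using q by simp
  then have "?\<epsilon> (var 2 * P 0) = ?\<epsilon> (var 0 * P 2)"
    by simp
  then have "P 2 = 0"
    by (simp add: subst_hom \<epsilon>P)
  then show False
    using P[of 2] r \<open>p \<noteq> 0\<close> by simp
qed

lemma form_subst:
  assumes F: "\<And>i. form 1 (F i)" and p: "form n p"
  shows "form n (subst F p)"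
  unfolding subst_def
proof (rule form_sum)
  fix m assume "m \<in> keys p"
  then have n: "n = 0 + (int (lookup m 0) + int (lookup m 1) + int (lookup m 2))"
    using p by (auto simp: form_def mdeg_3)
  have pow: "form (int k) (F i ^ k)" for i k
    using form_power[OF F, of k i] by simp
  show "form n (const (lookup p m) * (\<Prod>i\<in>UNIV. F i ^ lookup m i))"
    unfolding n prod_3 by (intro form_mult form_const pow)
qed

text \<open>
  An inverse of the permuted map is obtained by permuting the variables in an inverse. It is
  used to exchange the first two components, as complementing exchanges the factors $x$ and
  $y$ of $xq, yq$.
\<close>

lemma cremona_permute:
  fixes F :: "3 \<Rightarrow> 'k::field pol3"
  assumes "cremona F" and \<tau>: "\<And>i. \<tau> (\<tau> i) = i"
  shows "cremona (\<lambda>i. F (\<tau> i))"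
proof -
  define S :: "'k pol3 \<Rightarrow> 'k pol3" where "S = subst (\<lambda>i. var (\<tau> i))"
  have SS: "S (S p) = p" for p
    by (simp add: S_def subst_subst \<tau>)
  from assms(1) obtain n G e p p' where F: "\<forall>i. form n (F i)" and G: "\<forall>i. form e (G i)"
    and nz: "p \<noteq> 0" "p' \<noteq> 0"
    and FG: "\<And>i. subst F (G i) = var i * p" and GF: "\<And>i. subst G (F i) = var i * p'"
    unfolding cremona_def by metis
  have Sp': "S p' \<noteq> 0"
    using SS[of p'] nz by (metis S_def subst_zero)
  have form_SG: "\<forall>i. form e (S (G i))"
    using G by (simp add: S_def form_subst)
  have FSG: "\<forall>i. subst (\<lambda>i. F (\<tau> i)) (S (G i)) = var i * p"
    by (simp add: S_def subst_subst \<tau> FG)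
  have SGF: "subst (\<lambda>i. S (G i)) (F (\<tau> i)) = var i * S p'" for i
  proof -
    have "subst (\<lambda>i. S (G i)) (F (\<tau> i)) = S (subst G (F (\<tau> i)))"
      by (simp add: S_def subst_subst)
    also have "\<dots> = var i * S p'"
      by (simp add: GF) (simp add: S_def subst_hom \<tau>)
    finally show ?thesis .
  qed
  show ?thesis
    unfolding cremona_def
  proof
    show "\<exists>n. \<forall>i. form n (F (\<tau> i))"
      using F by blast
    have "(\<forall>i. form e (S (G i))) \<and> p \<noteq> 0 \<and> S p' \<noteq> 0 \<and>
        (\<forall>i. subst (\<lambda>i. F (\<tau> i)) (S (G i)) = var i * p) \<and>
        (\<forall>i. subst (\<lambda>i. S (G i)) (F (\<tau> i)) = var i * S p')"
      using form_SG nz(1) Sp' FSG SGF by (intro conjI allI) auto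
    then show "\<exists>G e p p'. (\<forall>i. form e (G i)) \<and> p \<noteq> 0 \<and> p' \<noteq> 0 \<and>
        (\<forall>i. subst (\<lambda>i. F (\<tau> i)) (G i) = var i * p) \<and> (\<forall>i. subst G (F (\<tau> i)) = var i * p')"
      by (intro exI)
  qed
qed

lemma cremona_swap_xy:
  assumes "cremona (triple a b c)" shows "cremona (triple b a c)"
proof -
  define \<tau> where "\<tau> = triple (1 :: 3) 0 2"
  have "\<tau> (\<tau> i) = i" for i
    by (rule exhaust_3[of i]) (simp_all add: \<tau>_def)
  moreover have "triple a b c (\<tau> i) = triple b a c i" for i
    by (rule exhaust_3[of i]) (simp_all add: \<tau>_def)
  ultimately show ?thesis
    using cremona_permute[OF assms, of \<tau>] by simp
qed

section \<open>Affine charts\<close>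

text \<open>
  For $i = 0, 1$ the chart sets the other one of the variables $x, y$ equal to 1. The variable
  with index $i$ is the variable of the inner polynomial ring, and $z$ is the variable of the
  outer one.
\<close>

definition chart :: "3 \<Rightarrow> 'k::field pol3 \<Rightarrow> 'k poly poly" where
  "chart i = peval (\<lambda>a. [:[:a:]:])
     (\<lambda>j. if j = i then [:[:0, 1:]:] else if j = 2 then [:0, 1:] else 1)"

text \<open>
  The same chart on the line $z = 0$, with values in $k[t]$. It is used for forms in $x, y$.
\<close>

definition line_chart :: "3 \<Rightarrow> 'k::field pol3 \<Rightarrow> 'k poly" where
  "line_chart i = peval (\<lambda>a. [:a:]) (\<lambda>j. if j = i then [:0, 1:] else if j = 2 then 0 else 1)"

interpretation const_poly: coefficient_hom "\<lambda>a :: 'k::field. [:a:]"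
  by unfold_locales (simp_all add: one_pCons)

interpretation const_poly_poly: coefficient_hom "\<lambda>a :: 'k::field. [:[:a:]:]"
  by unfold_locales (simp_all add: one_pCons)

lemmas chart_hom = const_poly_poly.peval_hom[of "\<lambda>j. if j = i then [:[:0, 1:]:] else if j = 2 then [:0, 1:] else 1"
    for i, folded chart_def]
lemmas line_chart_hom = const_poly.peval_hom[of "\<lambda>j. if j = i then [:0, 1:] else if j = 2 then 0 else 1"
    for i, folded line_chart_def]

lemma chart_var: "chart i (var j) = (if j = i then [:[:0, 1:]:] else if j = 2 then [:0, 1:] else 1)"
  by (simp add: chart_def)

lemma line_chart_var: "line_chart i (var j) = (if j = i then [:0, 1:] else if j = 2 then 0 else 1)"
  by (simp add: line_chart_def)

lemma chart_const [simp]: "chart i (const a) = [:[:a:]:]"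
  by (simp add: chart_def)

lemma line_chart_const [simp]: "line_chart i (const a) = [:a:]"
  by (simp add: line_chart_def)

lemma chart_zero [simp]: "chart i 0 = 0"
  by (simp add: chart_def)

lemma line_chart_zero [simp]: "line_chart i 0 = 0"
  by (simp add: line_chart_def)

lemma chart_z_free:
  assumes "z_free p"
  shows "chart i p = [:line_chart i p:]"
proof -
  have "[:line_chart i p:] = peval (\<lambda>a. [:[:a:]:])
      (\<lambda>j. [:if j = i then [:0, 1:] else if j = 2 then 0 else 1:]) p"
    unfolding line_chart_def by (rule hom_peval) (simp_all add: one_pCons)
  also have "\<dots> = chart i p"
    unfolding chart_def by (rule peval_z_free_cong[OF assms]) (simp_all add: one_pCons)
  finally show ?thesis ..
qed

lemma chart_z_expansion:
  assumes "z_free a" "z_free b" "i \<noteq> 2"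
  shows "chart i (a + var 2 * b) = [:line_chart i a, line_chart i b:]"
  using assms by (simp add: chart_hom chart_var chart_z_free)

lemma chart_eq_sum:
  assumes "i = 0 \<or> i = 1"
  shows "chart i p = (\<Sum>m\<in>keys p. monom (monom (lookup p m) (lookup m i)) (lookup m 2))"
proof -
  have x: "[:[:0, 1 :: 'a:]:] ^ k = [:monom 1 k:]" "[:0, 1 :: 'a poly:] ^ k = monom 1 k" for k
    by (simp_all add: poly_const_pow monom_altdef)
  show ?thesis
    unfolding chart_def peval_def
    by (rule sum.cong) (use assms in \<open>auto simp: prod_3 x smult_monom\<close>)
qed

text \<open>
  Dehomogenization loses nothing on forms of a fixed degree: the exponent of the variable that
  was set to 1 can be read off from the other two.
\<close>

lemma coeff_chart:
  assumes i: "i = 0 \<or> i = 1" and p: "form n p" and m: "int (mdeg m) = n"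
  shows "coeff (coeff (chart i p) (lookup m 2)) (lookup m i) = lookup p m"
proof -
  have "coeff (coeff (chart i p) (lookup m 2)) (lookup m i)
      = (\<Sum>m'\<in>keys p. if m' = m then lookup p m' else 0)"
    unfolding chart_eq_sum[OF i] coeff_sum
  proof (rule sum.cong)
    fix m' assume "m' \<in> keys p"
    then have "mdeg m' = mdeg m"
      using p m by (auto simp: form_def)
    then have "m' = m \<longleftrightarrow> lookup m' 2 = lookup m 2 \<and> lookup m' i = lookup m i"
      using i by (auto simp: mdeg_3 intro: exponent_eqI)
    then show "coeff (coeff (monom (monom (lookup p m') (lookup m' i)) (lookup m' 2)) (lookup m 2))
          (lookup m i) = (if m' = m then lookup p m' else 0)"
      by auto
  qed simp
  then show ?thesis
    by (simp add: in_keys_iff)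
qed

lemma chart_eq_0:
  assumes "i = 0 \<or> i = 1" "form n p" "chart i p = 0"
  shows "p = 0"
proof -
  have "lookup p m = 0" for m
  proof (rule ccontr)
    assume "lookup p m \<noteq> 0"
    then have "int (mdeg m) = n"
      using assms by (auto simp: form_def in_keys_iff)
    then show False
      using coeff_chart[OF assms(1,2)] assms(3) \<open>lookup p m \<noteq> 0\<close> by simp
  qed
  then show ?thesis
    by (simp add: poly_mapping_eqI)
qed

lemma line_chart_eq_0:
  assumes "i = 0 \<or> i = 1" "form_xy n p" "line_chart i p = 0"
  shows "p = 0"
  using chart_eq_0[of i n p] assms by (simp add: form_xy_iff chart_z_free)

lemma degree_line_chart:
  assumes i: "i = 0 \<or> i = 1" and p: "form_xy (int n) p"
  shows "degree (line_chart i p) \<le> n"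
proof -
  have "line_chart i p = coeff (chart i p) 0"
    using p by (simp add: form_xy_iff chart_z_free)
  also have "\<dots> = (\<Sum>m\<in>keys p. monom (lookup p m) (lookup m i))"
    unfolding chart_eq_sum[OF i] coeff_sum
    by (rule sum.cong) (use p in \<open>auto simp: form_xy_def\<close>)
  also have "degree \<dots> \<le> n"
  proof (rule degree_sum_le)
    fix m assume "m \<in> keys p"
    then have "lookup m i \<le> n"
      using i p by (auto simp: form_xy_def form_def mdeg_3)
    then show "degree (monom (lookup p m) (lookup m i)) \<le> n"
      using degree_monom_le le_trans by blast
  qed simp
  finally show ?thesis .
qed

lemma hom_dvd:
  assumes "\<And>p q. \<phi> (p * q) = \<phi> p * \<phi> q" "p dvd q"
  shows "(\<phi> p :: 'b :: comm_semiring_1) dvd \<phi> (q :: 'a :: comm_semiring_1)"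
  using assms by (metis dvdE dvdI)

lemma chart_dvd: "p dvd q \<Longrightarrow> chart i p dvd chart i q"
  by (rule hom_dvd) (simp add: chart_hom)

lemma line_chart_dvd: "p dvd q \<Longrightarrow> line_chart i p dvd line_chart i q"
  by (rule hom_dvd) (simp add: line_chart_hom)

definition homogenize :: "nat \<Rightarrow> 'k::field poly \<Rightarrow> 'k pol3" where
  "homogenize n s = (\<Sum>i\<le>n. const (coeff s i) * (var 0 ^ (n - i) * var 1 ^ i))"

lemma form_xy_homogenize: "form_xy (int n) (homogenize n s)"
proof -
  have "form (int n) (const (coeff s i) * (var 0 ^ (n - i) * var 1 ^ i))" if "i \<le> n" for i
  proof -
    have "form (0 + (int (n - i) * 1 + int i * 1)) (const (coeff s i) * (var 0 ^ (n - i) * var 1 ^ i))"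
      by (intro form_mult form_const form_power form_var)
    then show ?thesis
      using that by simp
  qed
  then have "form (int n) (homogenize n s)"
    unfolding homogenize_def by (intro form_sum) simp
  moreover have "z_free (homogenize n s)"
    unfolding homogenize_def
    by (intro z_free_sum z_free_mult z_free_const z_free_power z_free_var)
  ultimately show ?thesis
    by (simp add: form_xy_iff)
qed

lemma line_chart_homogenize:
  assumes "degree s \<le> n"
  shows "line_chart 1 (homogenize n s) = s"
proof -
  have "line_chart 1 (homogenize n s) = (\<Sum>i\<le>n. line_chart 1 (const (coeff s i) * (var 0 ^ (n - i) * var 1 ^ i)))"
    unfolding homogenize_def line_chart_def by (rule const_poly.peval_sum)
  also have "\<dots> = (\<Sum>i\<le>n. monom (coeff s i) i)"
    by (simp add: line_chart_hom line_chart_var monom_altdef)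
  also have "\<dots> = s"
    using assms by (rule poly_as_sum_of_monoms')
  finally show ?thesis .
qed

text \<open>
  A factor of the dehomogenized form lifts to a factor of the form: the homogenizations of the
  two cofactors, in complementary degrees, multiply to a form with the same dehomogenization.
\<close>

lemma homogenize_dvd:
  assumes "s \<noteq> 0" "form_xy (int n) p" "s dvd line_chart 1 p"
  shows "homogenize (degree s) s dvd p"
proof (cases "p = 0")
  case False
  obtain r where r: "line_chart 1 p = s * r"
    using assms(3) by blast
  have "line_chart 1 p \<noteq> 0"
    using line_chart_eq_0[of 1] assms(2) False by blast
  then have "r \<noteq> 0"
    using r by auto
  have deg: "degree s + degree r \<le> n"
    using degree_line_chart[of 1 n p] assms r \<open>r \<noteq> 0\<close> by (simp add: degree_mult_eq)
  let ?u = "homogenize (degree s) s * homogenize (n - degree s) r"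
  have "form_xy (int (degree s) + int (n - degree s)) ?u"
    using form_xy_homogenize form_mult z_free_mult by (metis form_xy_iff)
  then have "form_xy (int n) (p - ?u)"
    using assms(2) deg by (simp add: form_xy_iff form_diff z_free_diff)
  moreover have "line_chart 1 (p - ?u) = 0"
    using deg by (simp add: line_chart_hom line_chart_homogenize r)
  ultimately have "p - ?u = 0"
    by (rule line_chart_eq_0[of 1, OF disjI2, OF refl])
  then show ?thesis
    by simp
qed simp

section \<open>Factors of forms\<close>

text \<open>
  Over a domain, a factor of $c X^n$ is $a X^k$: if $X$ divides a product then it divides a
  factor.
\<close>

lemma monom_factor:
  fixes p q :: "'a::idom poly"
  assumes "p * q = monom c n" "c \<noteq> 0"
  shows "\<exists>a k. p = monom a k"
  using assms
proof (induction n arbitrary: p q)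
  case 0
  then have "p * q \<noteq> 0" "degree (p * q) = 0"
    by (simp_all add: monom_0)
  then have "degree p = 0"
    by (auto simp: degree_mult_eq)
  then show ?case
    by (metis degree_0_id monom_0)
next
  case (Suc n)
  have "coeff (p * q) 0 = 0"
    using Suc.prems by simp
  then have "coeff p 0 = 0 \<or> coeff q 0 = 0"
    by (simp add: coeff_mult_0)
  then show ?case
  proof
    assume "coeff p 0 = 0"
    then obtain p' where p': "p = pCons 0 p'"
      by (metis coeff_pCons_0 pCons_cases)
    then have "p' * q = monom c n"
      using Suc.prems by (simp add: monom_Suc)
    then obtain a k where "p' = monom a k"
      using Suc by blast
    then show ?thesis
      using p' by (metis monom_Suc)
  next
    assume "coeff q 0 = 0"
    then obtain q' where q': "q = pCons 0 q'"
      by (metis coeff_pCons_0 pCons_cases)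
    then have "p * q' = monom c n"
      using Suc.prems by (simp add: monom_Suc)
    then show ?thesis
      using Suc by blast
  qed
qed

text \<open>
  The substitution $(xT, yT, zT)$. The coefficient of $T^k$ is the homogeneous component of
  degree $k$, so forms are the polynomials with monomial image. This turns
  \<open>monom_factor\<close> into the statement that factors of forms are forms.
\<close>

definition grading :: "'k::field pol3 \<Rightarrow> 'k pol3 poly" where
  "grading = peval (\<lambda>a. [:const a:]) (\<lambda>i. [:0, var i:])"

interpretation const_pol3_poly: coefficient_hom "\<lambda>a :: 'k::field. [:const a:]"
  by unfold_locales (simp_all add: const.hom_add const.hom_mult const.hom_one one_pCons)

lemma grading_eq_sum: "grading p = (\<Sum>m\<in>keys p. monom (single m (lookup p m)) (mdeg m))"
proof -
  have "[:const a:] * (\<Prod>i\<in>UNIV. [:0, var i:] ^ lookup m i) = monom (single m a) (mdeg m)"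
    for m and a :: 'a
  proof -
    have "const a * (\<Prod>i\<in>UNIV. var i ^ lookup m i) = single m a"
      using subst_var_id[of "single m a"] by (simp add: subst_eq_peval const.peval_single)
    moreover have "[:0, v:] ^ k = monom (v ^ k) k" for v :: "'a pol3" and k
      by (induction k) (simp_all add: monom_Suc monom_0 one_pCons smult_monom)
    ultimately show ?thesis
      by (simp add: prod_3 mult_monom smult_monom mdeg_3 mult.assoc)
  qed
  then show ?thesis
    by (simp add: grading_def peval_def)
qed

lemma lookup_coeff_grading:
  "lookup (coeff (grading p) k) m = (if mdeg m = k then lookup p m else 0)"
proof -
  have "lookup (coeff (grading p) k) m = (\<Sum>m'\<in>keys p. if m' = m then (if mdeg m = k then lookup p m else 0) else 0)"
    unfolding grading_eq_sum coeff_sum lookup_sum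
    by (rule sum.cong) (auto simp: lookup_single when_def)
  then show ?thesis
    by (simp add: in_keys_iff)
qed

lemma form_if_grading:
  assumes "grading p = monom a k"
  shows "form (int k) p"
  unfolding form_def
proof
  fix m assume "m \<in> keys p"
  then have "lookup (coeff (grading p) (mdeg m)) m \<noteq> 0"
    by (simp add: lookup_coeff_grading in_keys_iff)
  then show "int (mdeg m) = int k"
    using assms by (auto split: if_splits)
qed

lemma form_factor:
  assumes p: "form n p" "p \<noteq> 0" and u: "u dvd p"
  obtains k where "form (int k) u"
proof -
  obtain v where v: "p = u * v"
    using u by blast
  have "grading u * grading v = grading p"
    unfolding grading_def v by (simp add: const_pol3_poly.peval_mult)
  also have "grading p = monom p (nat n)"
  proof (rule poly_eqI, rule poly_mapping_eqI)
    fix k m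
    show "lookup (coeff (grading p) k) m = lookup (coeff (monom p (nat n)) k) m"
      using p(1) by (cases "lookup p m = 0") (auto simp: lookup_coeff_grading form_def in_keys_iff)
  qed
  finally obtain a k where "grading u = monom a k"
    using monom_factor p(2) by blast
  then show ?thesis
    using form_if_grading that by blast
qed

lemma const_dvd_1: "a \<noteq> 0 \<Longrightarrow> const a dvd 1"
  by (rule dvdI[of _ _ "const (inverse a)"]) (simp add: const.hom_one flip: const.hom_mult)

section \<open>Pencils of pairs of polynomials in one variable\<close>

lemma irreducible_factor:
  fixes p :: "'k::field poly"
  assumes "p \<noteq> 0" "\<not> p dvd 1"
  shows "\<exists>\<pi>. irreducible \<pi> \<and> \<pi> dvd p"
  using assms
proof (induction "degree p" arbitrary: p rule: less_induct)
  case less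
  show ?case
  proof (cases "irreducible p")
    case False
    then obtain a b where ab: "p = a * b" "\<not> a dvd 1" "\<not> b dvd 1"
      using less.prems unfolding irreducible_def by blast
    then have "a \<noteq> 0" "b \<noteq> 0"
      using less.prems by auto
    moreover have "degree b \<noteq> 0"
      using ab \<open>b \<noteq> 0\<close> by (simp add: is_unit_iff_degree)
    ultimately have "degree a < degree p"
      by (simp add: ab degree_mult_eq)
    then obtain \<pi> where "irreducible \<pi>" "\<pi> dvd a"
      using less.hyps \<open>a \<noteq> 0\<close> ab by blast
    then show ?thesis
      using ab by auto
  qed (use dvd_refl in blast)
qed

text \<open>
  A divisor of the members of the pencil $(A + aG, B + aH)$ at two distinct parameters divides
  $G$ and $H$, hence also $A$ and $B$.
\<close>

lemma dvd_pencil_eq: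
  fixes A B G H \<pi> :: "'k::field poly"
  assumes coprime: "\<And>p. p dvd A \<Longrightarrow> p dvd B \<Longrightarrow> p dvd G \<Longrightarrow> p dvd H \<Longrightarrow> p dvd 1"
    and \<pi>: "\<not> \<pi> dvd 1"
    and a: "\<pi> dvd A + [:a:] * G" "\<pi> dvd B + [:a:] * H"
    and b: "\<pi> dvd A + [:b:] * G" "\<pi> dvd B + [:b:] * H"
  shows "a = b"
proof (rule ccontr)
  assume "a \<noteq> b"
  have cancel: "\<pi> dvd Y \<and> \<pi> dvd X" if "\<pi> dvd X + [:a:] * Y" "\<pi> dvd X + [:b:] * Y" for X Y
  proof -
    have "\<pi> dvd (X + [:a:] * Y) - (X + [:b:] * Y)"
      using that by (rule dvd_diff)
    also have "(X + [:a:] * Y) - (X + [:b:] * Y) = smult (a - b) Y"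
      by (simp add: smult_diff_left)
    finally have "\<pi> dvd Y"
      using \<open>a \<noteq> b\<close> by (simp add: dvd_smult_iff)
    then have "\<pi> dvd [:a:] * Y"
      by (rule dvd_mult)
    then show ?thesis
      using that(1) \<open>\<pi> dvd Y\<close> dvd_add_left_iff by blast
  qed
  show False
    using cancel[OF a(1) b(1)] cancel[OF a(2) b(2)] coprime \<pi> by blast
qed

text \<open>
  An irreducible factor of $E$ belongs to at most one parameter $a$, and $E$ has finitely many
  irreducible factors up to units. The induction splits off one factor of $E$ at a time.
\<close>

lemma finite_pencil_common_factor:
  fixes A B G H E :: "'k::field poly"
  assumes coprime: "\<And>p. p dvd A \<Longrightarrow> p dvd B \<Longrightarrow> p dvd G \<Longrightarrow> p dvd H \<Longrightarrow> p dvd 1"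
    and "E \<noteq> 0"
  shows "finite {a. \<exists>\<pi>. irreducible \<pi> \<and> \<pi> dvd E \<and> \<pi> dvd A + [:a:] * G \<and> \<pi> dvd B + [:a:] * H}"
    (is "finite (?bad E)")
  using \<open>E \<noteq> 0\<close>
proof (induction "degree E" arbitrary: E rule: less_induct)
  case less
  show ?case
  proof (cases "?bad E = {}")
    case True
    show ?thesis
      unfolding True by (rule finite.emptyI)
  next
    case False
    then obtain a \<pi> where \<pi>: "irreducible \<pi>" "\<pi> dvd E"
      and a: "\<pi> dvd A + [:a:] * G" "\<pi> dvd B + [:a:] * H"
      by blast
    then obtain E' where E': "E = \<pi> * E'"
      by blast
    have nonunit: "\<not> \<rho> dvd 1" if "irreducible \<rho>" for \<rho> :: "'k poly"
      using that by (simp add: irreducible_def)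
    have "degree \<pi> \<noteq> 0" "E' \<noteq> 0"
      using nonunit[OF \<pi>(1)] \<pi>(1) less.prems E' by (auto simp: is_unit_iff_degree)
    then have "degree E' < degree E"
      using less.prems by (simp add: E' degree_mult_eq)
    then have "finite (?bad E')"
      using less.hyps \<open>E' \<noteq> 0\<close> by blast
    moreover have "?bad E \<subseteq> insert a (?bad E')"
    proof
      fix b assume "b \<in> ?bad E"
      then obtain \<rho> where \<rho>: "irreducible \<rho>" "\<rho> dvd E"
        and b: "\<rho> dvd A + [:b:] * G" "\<rho> dvd B + [:b:] * H"
        by blast
      then have "\<rho> dvd \<pi> \<or> \<rho> dvd E'"
        using field_poly_irreducible_imp_prime[OF \<rho>(1)] by (simp add: E' prime_elem_dvd_mult_iff)
      then show "b \<in> insert a (?bad E')"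
      proof
        assume "\<rho> dvd \<pi>"
        then have "\<rho> dvd A + [:a:] * G" "\<rho> dvd B + [:a:] * H"
          using a dvd_trans by blast+
        then have "b = a"
          using dvd_pencil_eq[of A B G H \<rho> b a] coprime nonunit[OF \<rho>(1)] b by blast
        then show ?thesis by simp
      qed (use \<rho> b in blast)
    qed
    ultimately show ?thesis
      by (meson finite_insert finite_subset)
  qed
qed

text \<open>
  A common divisor of the two entries $A + aG$ and $B + aH$ divides the determinant $AH - BG$,
  which does not depend on $a$, so \<open>finite_pencil_common_factor\<close> bounds the bad
  parameters.
\<close>

lemma coprime_pencil_member:
  fixes A B G H :: "'k::field poly"
  assumes inf: "infinite (UNIV :: 'k set)"
    and coprime: "\<And>p. p dvd A \<Longrightarrow> p dvd B \<Longrightarrow> p dvd G \<Longrightarrow> p dvd H \<Longrightarrow> p dvd 1"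
    and det: "A * H \<noteq> B * G"
  obtains a where "B + [:a:] * H \<noteq> 0"
    and "\<And>p. p dvd A + [:a:] * G \<Longrightarrow> p dvd B + [:a:] * H \<Longrightarrow> p dvd 1"
proof -
  define \<Delta> where "\<Delta> = A * H - B * G"
  have "\<Delta> \<noteq> 0"
    using det by (simp add: \<Delta>_def)
  define bad where "bad = {a. \<exists>\<pi>. irreducible \<pi> \<and> \<pi> dvd \<Delta> \<and> \<pi> dvd A + [:a:] * G \<and> \<pi> dvd B + [:a:] * H}"
  have "finite bad"
    unfolding bad_def using finite_pencil_common_factor[of A B G H \<Delta>] coprime \<open>\<Delta> \<noteq> 0\<close> by blast
  moreover have "finite {a. B + [:a:] * H = 0}"
  proof (rule ccontr)
    assume inf0: "infinite {a. B + [:a:] * H = 0}"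
    then obtain a where a: "B + [:a:] * H = 0"
      using not_finite_existsD by blast
    obtain b where b: "B + [:b:] * H = 0" "a \<noteq> b"
      using inf0 by (metis (mono_tags, lifting) finite.emptyI finite_insert finite_subset insertCI mem_Collect_eq subsetI)
    have "smult (a - b) H = (B + [:a:] * H) - (B + [:b:] * H)"
      by (simp add: smult_diff_left)
    also have "\<dots> = 0"
      unfolding a b by simp
    finally have "H = 0"
      using b by simp
    then show False
      using a det by simp
  qed
  ultimately obtain a where a: "a \<notin> bad" "B + [:a:] * H \<noteq> 0"
    using inf by (metis (mono_tags, lifting) UNIV_eq_I UnCI finite_Un mem_Collect_eq)
  have "p dvd 1" if p: "p dvd A + [:a:] * G" "p dvd B + [:a:] * H" for p
  proof (rule ccontr)
    assume "\<not> p dvd 1"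
    moreover have "p \<noteq> 0"
      using p a by auto
    ultimately obtain \<pi> where \<pi>: "irreducible \<pi>" "\<pi> dvd p"
      using irreducible_factor by blast
    then have *: "\<pi> dvd A + [:a:] * G" "\<pi> dvd B + [:a:] * H"
      using p dvd_trans by blast+
    then have "\<pi> dvd (A + [:a:] * G) * H - (B + [:a:] * H) * G"
      by simp
    also have "(A + [:a:] * G) * H - (B + [:a:] * H) * G = \<Delta>"
      by (simp add: \<Delta>_def algebra_simps)
    finally show False
      using a * \<pi> by (auto simp: bad_def)
  qed
  then show ?thesis
    using that a by blast
qed

lemma const_poly_dvd_linear:
  fixes a b c :: "'a::comm_semiring_1"
  assumes "c dvd a" "c dvd b" shows "[:c:] dvd [:a, b:]"
proof -
  obtain r s where "a = c * r" "b = c * s"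
    using assms by blast
  then have "[:a, b:] = [:c:] * [:r, s:]"
    by (simp add: mult.commute)
  then show ?thesis
    by (rule dvdI)
qed

text \<open>
  By degrees, the cofactor is constant, so the two linear polynomials are proportional.
\<close>

lemma cross_product_eq_if_dvd_linear:
  fixes a b c d :: "'a::idom"
  assumes "[:a, b:] dvd [:c, d:]" "b \<noteq> 0"
  shows "a * d = b * c"
proof -
  obtain r where r: "[:c, d:] = [:a, b:] * r"
    using assms(1) by blast
  have "degree r = 0"
  proof (rule ccontr)
    assume "degree r \<noteq> 0"
    then have "degree ([:a, b:] * r) = 1 + degree r"
      using assms(2) by (subst degree_mult_eq) auto
    moreover have "degree [:c, d:] \<le> 1"
      by simp
    ultimately show False
      using \<open>degree r \<noteq> 0\<close> unfolding r by simp
  qed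
  then obtain s where "r = [:s:]"
    using degree_eq_zeroE by blast
  then show ?thesis
    using r by simp
qed

section \<open>A criterion for de Jonquieres maps\<close>

text \<open>
  A factor of a form is a form, and a form which is constant in the chart $y = 1$ is a
  constant multiple of a power of $y$. The hypothesis on the chart $x = 1$ ensures that $y$
  does not divide $f$.
\<close>

lemma is_unit_if_chart_const:
  assumes f: "form n f" "f \<noteq> 0" and u: "u dvd f"
    and y: "\<not> [:[:0, 1:]:] dvd chart 1 f"
    and c: "chart 0 u = [:c:]" "c dvd 1"
  shows "u dvd 1"
proof -
  obtain a where a: "c = [:a:]" "a \<noteq> 0"
    using c(2) by (auto simp: is_unit_poly_iff dvd_field_iff)
  obtain k where k: "form (int k) u"
    using form_factor f u by blast
  have "form (0 + int k * 1) (const a * var 1 ^ k)"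
    by (intro form_mult form_const form_power form_var)
  then have "form (int k) (u - const a * var 1 ^ k)"
    using k by (simp add: form_diff)
  moreover have "chart 0 (u - const a * var 1 ^ k) = 0"
    using c a by (simp add: chart_hom chart_var)
  ultimately have u_eq: "u = const a * var 1 ^ k"
    using chart_eq_0[of 0 "int k" "u - const a * var 1 ^ k"] by simp
  show ?thesis
  proof (cases k)
    case 0
    then show ?thesis
      using u_eq a const_dvd_1 by simp
  next
    case (Suc l)
    then have "var 1 dvd f"
      using u u_eq by (metis dvd_mult dvd_mult_left dvd_trans dvd_triv_left power_Suc)
    then have "chart 1 (var 1) dvd chart 1 f"
      by (rule chart_dvd)
    then show ?thesis
      using y by (simp add: chart_var)
  qed
qed

text \<open>
  In the chart $y = 1$ the form is linear in $z$, so one of two cofactors has degree 0 in $z$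
  there. It then divides both coefficients, which are coprime.
\<close>

lemma irreducible_if_chart:
  assumes f: "form n f" and chart: "chart 0 f = [:b, a:]" and "a \<noteq> 0"
    and coprime: "\<And>p. p dvd b \<Longrightarrow> p dvd a \<Longrightarrow> p dvd 1"
    and y: "\<not> [:[:0, 1:]:] dvd chart 1 f"
  shows "irreducible f"
proof (rule irreducibleI)
  show "f \<noteq> 0"
    using chart \<open>a \<noteq> 0\<close> by auto
  have unit: "u dvd 1" if uv: "u * v = f" and deg: "degree (chart 0 u) = 0" for u v
  proof -
    obtain c where c: "chart 0 u = [:c:]"
      using degree_eq_zeroE[OF deg] by blast
    have "chart 0 u dvd chart 0 f"
      using uv by (intro chart_dvd) auto
    then have "c dvd b \<and> c dvd a"
      unfolding c chart const_poly_dvd_iff by (metis coeff_pCons_0 coeff_pCons_Suc)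
    then have "c dvd 1"
      using coprime by blast
    then show ?thesis
      using is_unit_if_chart_const[OF f \<open>f \<noteq> 0\<close> _ y c] uv by auto
  qed
  have deg: "degree (chart 0 u) + degree (chart 0 v) = 1" if "u * v = f" for u v
  proof -
    have "chart 0 u * chart 0 v = [:b, a:]"
      using that chart by (simp flip: chart_hom)
    then show ?thesis
      using degree_mult_eq[of "chart 0 u" "chart 0 v"] \<open>a \<noteq> 0\<close>
      by (metis One_nat_def degree_0 degree_pCons_0 degree_pCons_eq mult_eq_0_iff pCons_eq_0_iff)
  qed
  show "\<not> f dvd 1"
  proof
    assume "f dvd 1"
    then have "chart 0 f dvd chart 0 1"
      by (rule chart_dvd)
    then have "degree (chart 0 f) = 0"
      by (auto simp: chart_hom is_unit_poly_iff)
    then show False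
      using chart \<open>a \<noteq> 0\<close> by simp
  qed
  show "u dvd 1 \<or> v dvd 1" if "f = u * v" for u v
  proof (cases "degree (chart 0 u) = 0")
    case True
    then show ?thesis
      using unit that by blast
  next
    case False
    then have "degree (chart 0 v) = 0"
      using deg[of u v] that by simp
    then show ?thesis
      using unit[of v u] that by (simp add: mult.commute)
  qed
qed

lemma linear_system_triple:
  "linear_system (triple a b c) = {const r * a + const s * b + const t * c | r s t. True}"
proof -
  have "(\<exists>k. p = const (k 0) * a + const (k (1::3)) * b + const (k 2) * c)
      \<longleftrightarrow> (\<exists>r s t. p = const r * a + const s * b + const t * c)" for p
  proof
    assume "\<exists>r s t. p = const r * a + const s * b + const t * c"
    then obtain r s t where "p = const r * a + const s * b + const t * c"
      by blast
    then show "\<exists>k. p = const (k 0) * a + const (k (1::3)) * b + const (k 2) * c"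
      by (intro exI[of _ "triple r s t"]) simp
  qed blast
  then show ?thesis
    by (simp add: linear_system_def sum_3)
qed

lemma linear_system_shear:
  "linear_system (triple b a c) = linear_system (triple a b (c + (const r * a + const s * b)))"
  (is "?L = ?R")
proof
  show "?L \<subseteq> ?R"
  proof
    fix p assume "p \<in> ?L"
    then obtain u v w where "p = const u * b + const v * a + const w * c"
      by (auto simp: linear_system_triple)
    then have "p = const (v - w * r) * a + const (u - w * s) * b + const w * (c + (const r * a + const s * b))"
      using const.hom_add[of "v - w * r" "w * r"] const.hom_add[of "u - w * s" "w * s"]
      by (simp add: const.hom_mult algebra_simps)
    then show "p \<in> ?R"
      by (auto simp: linear_system_triple)
  qed
  show "?R \<subseteq> ?L"
  proof
    fix p assume "p \<in> ?R"
    then obtain u v w where "p = const u * a + const v * b + const w * (c + (const r * a + const s * b))"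
      by (auto simp: linear_system_triple)
    then have "p = const (v + w * s) * b + const (u + w * r) * a + const w * c"
      by (simp add: const.hom_mult const.hom_add algebra_simps)
    then show "p \<in> ?L"
      unfolding linear_system_triple by blast
  qed
qed

text \<open>
  The hypothesis \<open>affine\<close> says that $q$ and $f$ have no common factor in $x, y$
  in the chart $y = 1$, and \<open>y\<close> excludes the remaining possibility, that $y$
  divides both. The order of the first two components is the one which occurs for the dual.
\<close>

lemma de_jonquieres_criterion:
  fixes g h f0 f1 :: "'k::field pol3"
  assumes inf: "infinite (UNIV :: 'k set)" and n: "n \<ge> 1"
    and g: "form_xy (n - 1) g" and h: "form_xy (n - 2) h" and q: "q = g + var 2 * h"
    and f0: "form_xy n f0" and f1: "form_xy (n - 1) f1" and f: "f = f0 + var 2 * f1"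
    and D: "g * f1 \<noteq> f0 * h"
    and affine: "\<And>p. p dvd line_chart 0 g \<Longrightarrow> p dvd line_chart 0 h \<Longrightarrow>
      p dvd line_chart 0 f0 \<Longrightarrow> p dvd line_chart 0 f1 \<Longrightarrow> p dvd 1"
    and y: "\<not> ([:[:0, 1:]:] dvd chart 1 q \<and> [:[:0, 1:]:] dvd chart 1 f)"
  shows "de_jonquieres n (triple (var 1 * q) (var 0 * q) f)"
proof -
  have zf: "z_free g" "z_free h" "z_free f0" "z_free f1"
    using g h f0 f1 by (simp_all add: form_xy_iff)
  define G H A0 B0 where "G = line_chart 0 g" and "H = line_chart 0 h"
    and "A0 = line_chart 0 f0" and "B0 = line_chart 0 f1"
  \<comment> \<open>If $y$ divides $f$, then it does not divide $q$, and hence not $f + xq$.\<close>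
  define c :: 'k where "c = (if [:[:0, 1:]:] dvd chart 1 f then 1 else 0)"
  define A B where "A = A0 + [:0, c:] * G" and "B = B0 + [:0, c:] * H"
  have "form_xy (2 * n - 2) (g * f1 - f0 * h)"
    using form_xy_mult[OF g f1] form_xy_mult[OF f0 h] by (simp add: form_xy_diff)
  then have "line_chart 0 (g * f1 - f0 * h) \<noteq> 0"
    using line_chart_eq_0[of 0] D by fastforce
  then have "G * B0 \<noteq> A0 * H"
    by (simp add: G_def H_def A0_def B0_def line_chart_hom)
  then have det: "A * H \<noteq> B * G"
    by (auto simp: A_def B_def algebra_simps)
  have coprime: "p dvd 1" if p: "p dvd A" "p dvd B" "p dvd G" "p dvd H" for p
  proof -
    have "p dvd A - [:0, c:] * G" "p dvd B - [:0, c:] * H"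
      using p by (simp_all only: dvd_diff dvd_mult)
    then have "p dvd A0" "p dvd B0"
      by (simp_all add: A_def B_def)
    then show ?thesis
      using affine p by (simp add: G_def H_def A0_def B0_def)
  qed
  obtain a where B': "B + [:a:] * H \<noteq> 0"
    and coprime': "\<And>p. p dvd A + [:a:] * G \<Longrightarrow> p dvd B + [:a:] * H \<Longrightarrow> p dvd 1"
    using coprime_pencil_member[OF inf coprime det] by blast
  \<comment> \<open>In the chart $y = 1$ the linear form $cx + ay$ becomes $ct + a$.\<close>
  define l where "l = const c * var 0 + const a * var 1"
  define f' where "f' = f + l * q"
  have f'_eq: "f' = (f0 + l * g) + var 2 * (f1 + l * h)"
    by (simp add: f'_def f q algebra_simps)
  have "form (0 + 1) l" "z_free l"
    unfolding l_def by (intro form_add form_mult z_free_add z_free_mult; simp)+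
  then have l: "form_xy 1 l"
    by (simp add: form_xy_iff)
  have lg: "form_xy n (f0 + l * g)"
    using form_xy_mult[OF l g] f0 by (simp add: form_xy_add)
  have lh: "form_xy (n - 1) (f1 + l * h)"
    using form_xy_mult[OF l h] f1 by (simp add: form_xy_add)
  have form_q: "form (n - 1) q"
    using form_z_expansion[of "n - 1" g h] g h by (simp add: q)
  have form_f: "form n f"
    using form_z_expansion[of n f0 f1] f0 f1 by (simp add: f)
  have form_f': "form n f'"
    using form_mult[of 1 l "n - 1" q] form_q form_f l by (simp add: f'_def form_add form_xy_iff)
  have l_chart: "line_chart 0 l = [:a, c:]"
    by (simp add: l_def line_chart_hom line_chart_var)
  have chart_f': "chart 0 f' = [:A + [:a:] * G, B + [:a:] * H:]"
  proof -
    have "chart 0 f' = [:line_chart 0 (f0 + l * g), line_chart 0 (f1 + l * h):]"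
      unfolding f'_eq by (rule chart_z_expansion) (use lg lh in \<open>simp_all add: form_xy_iff\<close>)
    then show ?thesis
      by (simp add: line_chart_hom l_chart A_def B_def A0_def B0_def G_def H_def algebra_simps)
  qed
  have y': "\<not> [:[:0, 1:]:] dvd chart 1 f'"
  proof
    assume dvd: "[:[:0, 1:]:] dvd chart 1 f'"
    have chart: "chart 1 f' = chart 1 f + [:[:c:]:] * chart 1 q + [:[:0, 1:]:] * ([:[:a:]:] * chart 1 q)"
      by (simp add: f'_def l_def chart_hom chart_var algebra_simps)
    then have dvd': "[:[:0, 1:]:] dvd chart 1 f + [:[:c:]:] * chart 1 q"
      using dvd dvd_add_left_iff dvd_triv_left by metis
    show False
    proof (cases "[:[:0, 1:]:] dvd chart 1 f")
      case True
      then have "[:[:0, 1:]:] dvd chart 1 q"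
        using dvd' dvd_add_right_iff[OF True] by (simp add: c_def flip: one_pCons)
      then show False
        using True y by blast
    next
      case False
      then show False
        using dvd' by (simp add: c_def)
    qed
  qed
  have irr: "irreducible f'"
    using irreducible_if_chart[OF form_f' chart_f' B' _ y'] coprime' by blast
  \<comment> \<open>A common factor that is not a unit would be $f'$ itself up to a unit, but $f'$ divides $yq$ only if $\Delta = 0$.\<close>
  have gcd: "p dvd 1" if p: "p dvd var 1 * q" "p dvd var 0 * q" "p dvd f" for p
  proof (rule ccontr)
    assume "\<not> p dvd 1"
    have "f' = f + (const c * (var 0 * q) + const a * (var 1 * q))"
      by (simp add: f'_def l_def algebra_simps)
    then have "p dvd f'"
      using p by (simp add: dvd_add dvd_mult)
    then obtain w where w: "f' = p * w"
      by blast
    then have "w dvd 1"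
      using irr \<open>\<not> p dvd 1\<close> irreducibleD by blast
    then obtain w' where "1 = w * w'"
      by blast
    then have "f' * w' = p"
      by (simp add: w mult.assoc)
    then have "f' dvd p"
      by (metis dvd_triv_left)
    then have "f' dvd var 1 * q"
      using p(1) by (rule dvd_trans)
    then have "chart 0 f' dvd chart 0 (var 1 * q)"
      by (rule chart_dvd)
    also have "chart 0 (var 1 * q) = [:G, H:]"
      using zf by (simp add: chart_hom chart_var q chart_z_free G_def H_def)
    finally have "(A + [:a:] * G) * H = (B + [:a:] * H) * G"
      unfolding chart_f' using B' by (rule cross_product_eq_if_dvd_linear)
    then show False
      using det by (simp add: algebra_simps)
  qed
  have "q \<noteq> 0"
    using z_expansion_eq_0[of g h] zf D by (auto simp: q)
  then obtain m where m: "m \<in> keys q"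
    by (metis keys_eq_empty ex_in_conv)
  have vars: "\<exists>j. \<exists>m\<in>keys (triple (var 1 * q) (var 0 * q) f j). lookup m i \<noteq> 0" for i
  proof (rule exhaust_3[of i])
    assume "i = 0"
    then show ?thesis
      using m by (intro exI[of _ 1] bexI[of _ "single 0 1 + m"]) (auto simp: keys_var_times lookup_add)
  next
    assume "i = 1"
    then show ?thesis
      using m by (intro exI[of _ 0] bexI[of _ "single 1 1 + m"]) (auto simp: keys_var_times lookup_add)
  next
    assume i: "i = 2"
    have "h \<noteq> 0 \<or> f1 \<noteq> 0"
      using D by auto
    then show ?thesis
    proof
      assume "h \<noteq> 0"
      then obtain m where "m \<in> keys h"
        by (metis keys_eq_empty ex_in_conv)
      then have "single 1 1 + (single 2 1 + m) \<in> keys (var 1 * q)"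
        using zf by (simp add: keys_var_times q keys_z_expansion)
      then show ?thesis
        using i by (intro exI[of _ 0] bexI[of _ "single 1 1 + (single 2 1 + m)"]) (auto simp: lookup_add)
    next
      assume "f1 \<noteq> 0"
      then obtain m where "m \<in> keys f1"
        by (metis keys_eq_empty ex_in_conv)
      then have "single 2 1 + m \<in> keys f"
        using zf by (simp add: f keys_z_expansion)
      then show ?thesis
        using i by (intro exI[of _ 2] bexI[of _ "single 2 1 + m"]) (auto simp: lookup_add)
    qed
  qed
  have "canonical_restrictions (triple (var 1 * q) (var 0 * q) f)"
    unfolding canonical_restrictions_def using gcd vars by (simp add: all_3)
  moreover have "cremona (triple (var 1 * q) (var 0 * q) f)"
    using cremona_swap_xy cremona_if_determinant[OF n g h f0 f1 D] unfolding q f by blast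
  moreover have "form n (triple (var 1 * q) (var 0 * q) f i)" for i
    using form_mult[OF form_var form_q] form_f by (simp add: triple_def)
  moreover have "z_monoid (n - 1) q"
    unfolding z_monoid_def using g h q by (auto simp: algebra_simps)
  moreover have "z_monoid n f'"
    unfolding z_monoid_def using lg lh f'_eq by blast
  moreover have "linear_system (triple (var 1 * q) (var 0 * q) f)
      = linear_system (triple (var 0 * q) (var 1 * q) f')"
    using linear_system_shear[of "var 1 * q" "var 0 * q" f c a]
    by (simp add: f'_def l_def algebra_simps)
  ultimately show ?thesis
    unfolding de_jonquieres_def using irr by blast
qed

section \<open>The Newton complementary dual\<close>

text \<open>
  The dual of a single form with respect to a given vector of exponents. Having the vector as
  a parameter allows it to differ between the coefficients of an expansion in $z$.
\<close>

definition complement :: "(3 \<Rightarrow>\<^sub>0 nat) \<Rightarrow> 'k::field pol3 \<Rightarrow> 'k pol3" where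
  "complement \<alpha> p = (\<Sum>m\<in>keys p. single (\<alpha> - m) (lookup p m))"

lemma newton_dual_eq_complement: "newton_dual F j = complement (max_exponents F) (F j)"
  by (simp add: newton_dual_def complement_def)

lemma complement_eq_sum:
  assumes "finite S" "keys p \<subseteq> S"
  shows "complement \<alpha> p = (\<Sum>m\<in>S. single (\<alpha> - m) (lookup p m))"
  unfolding complement_def
  by (rule sum.mono_neutral_left) (use assms in \<open>auto simp: in_keys_iff\<close>)

lemma complement_add: "complement \<alpha> (p + q) = complement \<alpha> p + complement \<alpha> q"
proof -
  let ?S = "keys p \<union> keys q"
  have "keys (p + q) \<subseteq> ?S"
    by (rule Poly_Mapping.keys_add)
  then show ?thesis
    by (simp add: complement_eq_sum[of ?S] lookup_add single_add sum.distrib)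
qed

lemma complement_zero [simp]: "complement \<alpha> 0 = 0"
  by (simp add: complement_def)

lemma complement_sum: "complement \<alpha> (sum p A) = (\<Sum>a\<in>A. complement \<alpha> (p a))"
  by (induction A rule: infinite_finite_induct) (simp_all add: complement_add)

lemma complement_single: "complement \<alpha> (single m a) = single (\<alpha> - m) a"
  using complement_eq_sum[of "{m}" "single m a" \<alpha>] by simp

definition exponents_le :: "(3 \<Rightarrow>\<^sub>0 nat) \<Rightarrow> 'k::field pol3 \<Rightarrow> bool" where
  "exponents_le \<alpha> p \<longleftrightarrow> (\<forall>m\<in>keys p. \<forall>i. lookup m i \<le> lookup \<alpha> i)"

text \<open>
  Complementing exchanges a monomial factor with exponents $a$ for what $a$ leaves of the part
  $a + b$ of $\alpha$.
\<close>

lemma complement_single_times: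
  fixes p :: "'k::field pol3"
  assumes "exponents_le \<beta> p" and \<alpha>: "\<alpha> = a + b + \<beta>"
  shows "complement \<alpha> (single a 1 * p) = single b 1 * complement \<beta> p"
proof -
  have shift: "\<alpha> - (a + m) = b + (\<beta> - m)" if "m \<in> keys p" for m
  proof (rule poly_mapping_eqI)
    fix i
    have "lookup m i \<le> lookup \<beta> i"
      using that assms by (simp add: exponents_le_def)
    then show "lookup (\<alpha> - (a + m)) i = lookup (b + (\<beta> - m)) i"
      by (simp add: \<alpha> lookup_add lookup_minus)
  qed
  have "complement \<alpha> (single a 1 * p) = (\<Sum>m\<in>keys p. single (b + (\<beta> - m)) (lookup p m))"
    by (simp add: single_times_eq_sum complement_sum complement_single shift)
  also have "\<dots> = single b 1 * complement \<beta> p"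
    by (simp add: complement_def sum_distrib_left mult_single)
  finally show ?thesis .
qed

lemma lookup_complement:
  assumes "exponents_le \<alpha> p" "m \<in> keys p"
  shows "lookup (complement \<alpha> p) (\<alpha> - m) = lookup p m"
proof -
  have "lookup (complement \<alpha> p) (\<alpha> - m) = (\<Sum>m'\<in>keys p. if m' = m then lookup p m' else 0)"
    unfolding complement_def lookup_sum
  proof (rule sum.cong)
    fix m' assume m': "m' \<in> keys p"
    have "\<alpha> - m' = \<alpha> - m \<longleftrightarrow> m' = m"
    proof
      assume eq: "\<alpha> - m' = \<alpha> - m"
      show "m' = m"
      proof (rule poly_mapping_eqI)
        fix i
        have "lookup \<alpha> i - lookup m' i = lookup \<alpha> i - lookup m i"
          using eq by (metis lookup_minus)
        then show "lookup m' i = lookup m i"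
          using assms m' by (auto simp: exponents_le_def) (metis diff_diff_cancel)
      qed
    qed simp
    then show "lookup (single (\<alpha> - m') (lookup p m')) (\<alpha> - m) = (if m' = m then lookup p m' else 0)"
      by (simp add: lookup_single when_def)
  qed simp
  then show ?thesis
    using assms(2) by simp
qed

lemma keys_complement_subset: "keys (complement \<alpha> p) \<subseteq> (\<lambda>m. \<alpha> - m) ` keys p"
  unfolding complement_def
  by (rule order_trans[OF keys_sum]) auto

lemma form_complement:
  assumes "form n p" "exponents_le \<alpha> p"
  shows "form (int (mdeg \<alpha>) - n) (complement \<alpha> p)"
  unfolding form_def
proof
  fix m' assume "m' \<in> keys (complement \<alpha> p)"
  then obtain m where m: "m \<in> keys p" "m' = \<alpha> - m"
    using keys_complement_subset by blast
  then have "lookup m 0 \<le> lookup \<alpha> 0" "lookup m 1 \<le> lookup \<alpha> 1" "lookup m 2 \<le> lookup \<alpha> 2"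
    using assms(2) by (auto simp: exponents_le_def)
  then have "int (mdeg m') = int (mdeg \<alpha>) - int (mdeg m)"
    by (simp add: m mdeg_3 lookup_minus)
  then show "int (mdeg m') = int (mdeg \<alpha>) - n"
    using assms(1) m by (simp add: form_def)
qed

lemma z_free_complement:
  assumes "lookup \<alpha> 2 = 0" shows "z_free (complement \<alpha> p)"
  using keys_complement_subset[of \<alpha> p] assms by (auto simp: z_free_def lookup_minus)

lemma line_chart_single:
  assumes "i = 0 \<or> i = 1" "lookup m 2 = 0"
  shows "line_chart i (single m a) = monom a (lookup m i)"
  using assms by (auto simp: line_chart_def const_poly.peval_single prod_3 monom_altdef)

text \<open>
  The term $x^{n-j} y^j$ becomes $t^j$ in the chart $x = 1$, and its complement, with exponent
  $\alpha_0 - n + j$ of $x$, becomes $t^{\alpha_0 - n + j}$ in the chart $y = 1$. Since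
  $\alpha_0 - n$ may have either sign, the powers $t^n$ and $t^{\alpha_0}$ stand on different
  sides.
\<close>

lemma line_chart_complement:
  assumes p: "form_xy (int n) p" and le: "exponents_le \<alpha> p" and \<alpha>: "lookup \<alpha> 2 = 0"
  shows "line_chart 0 (complement \<alpha> p) * [:0, 1:] ^ n = [:0, 1:] ^ lookup \<alpha> 0 * line_chart 1 p"
proof -
  have monom: "monom c k * [:0, 1:] ^ l = monom c (k + l)" for c :: 'a and k l
    by (simp add: monom_altdef power_add)
  have "line_chart 0 (complement \<alpha> p) = (\<Sum>m\<in>keys p. line_chart 0 (single (\<alpha> - m) (lookup p m)))"
    unfolding complement_def line_chart_def by (rule const_poly.peval_sum)
  then have "line_chart 0 (complement \<alpha> p) * [:0, 1:] ^ n
      = (\<Sum>m\<in>keys p. monom (lookup p m) (lookup \<alpha> 0 - lookup m 0 + n))"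
    by (simp add: line_chart_single lookup_minus \<alpha> monom sum_distrib_right)
  also have "\<dots> = (\<Sum>m\<in>keys p. monom (lookup p m) (lookup m 1 + lookup \<alpha> 0))"
  proof (rule sum.cong)
    fix m assume "m \<in> keys p"
    then have "lookup m 0 + lookup m 1 = n" "lookup m 0 \<le> lookup \<alpha> 0"
      using p le by (auto simp: form_xy_def form_def mdeg_3 exponents_le_def)
    then have "lookup \<alpha> 0 - lookup m 0 + n = lookup m 1 + lookup \<alpha> 0"
      by arith
    then show "monom (lookup p m) (lookup \<alpha> 0 - lookup m 0 + n)
        = monom (lookup p m) (lookup m 1 + lookup \<alpha> 0)"
      by simp
  qed simp
  also have "\<dots> = [:0, 1:] ^ lookup \<alpha> 0 * line_chart 1 (\<Sum>m\<in>keys p. single m (lookup p m))"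
  proof -
    have "line_chart 1 (\<Sum>m\<in>keys p. single m (lookup p m))
        = (\<Sum>m\<in>keys p. monom (lookup p m) (lookup m 1))"
      using p unfolding line_chart_def const_poly.peval_sum
      by (intro sum.cong) (simp_all add: line_chart_single form_xy_def flip: line_chart_def)
    then show ?thesis
      by (simp add: mult.commute[of "[:0, 1:] ^ _"] sum_distrib_right monom)
  qed
  finally show ?thesis
    by (simp only: poly_mapping_sum_single)
qed

lemma lookup_max_exponents:
  "lookup (max_exponents F) i = Max ((\<lambda>m. lookup m i) ` (\<Union>j. keys (F j)))"
proof -
  have "lookup (max_exponents F) i
      = (\<Sum>j\<in>UNIV. if j = i then Max ((\<lambda>m. lookup m j) ` (\<Union>l. keys (F l))) else 0)"
    unfolding max_exponents_def lookup_sum by (simp add: lookup_single when_def)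
  then show ?thesis
    by simp
qed

lemma exponents_le_max_exponents: "exponents_le (max_exponents F) (F j)"
  by (auto simp: exponents_le_def lookup_max_exponents intro!: Max_ge)

lemma max_exponent_attained:
  assumes "F j \<noteq> 0"
  obtains l m where "m \<in> keys (F l)" "lookup m i = lookup (max_exponents F) i"
proof -
  have "keys (F j) \<noteq> {}"
    using assms by simp
  then have "Max ((\<lambda>m. lookup m i) ` (\<Union>j. keys (F j))) \<in> (\<lambda>m. lookup m i) ` (\<Union>j. keys (F j))"
    by (intro Max_in) auto
  then show ?thesis
    using that by (auto simp: lookup_max_exponents)
qed

text \<open>
  A term that attains the maximal exponent of a variable becomes a term of the dual without
  this variable.
\<close>

lemma newton_dual_not_dvd:
  assumes i: "i = 0 \<or> i = 1" and F: "\<And>j. form n (F j)" and nz: "F j \<noteq> 0"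
  obtains l where "\<not> [:[:0, 1:]:] dvd chart i (newton_dual F l)"
proof -
  let ?\<alpha> = "max_exponents F"
  obtain l m where m: "m \<in> keys (F l)" "lookup m i = lookup ?\<alpha> i"
    using max_exponent_attained nz by metis
  have le: "exponents_le ?\<alpha> (F l)"
    by (rule exponents_le_max_exponents)
  have lookup: "lookup (newton_dual F l) (?\<alpha> - m) = lookup (F l) m"
    unfolding newton_dual_eq_complement using le m(1) by (rule lookup_complement)
  have form: "form (int (mdeg ?\<alpha>) - n) (newton_dual F l)"
    unfolding newton_dual_eq_complement using F le by (rule form_complement)
  have "?\<alpha> - m \<in> keys (newton_dual F l)"
    using m(1) by (simp add: in_keys_iff lookup)
  then have "int (mdeg (?\<alpha> - m)) = int (mdeg ?\<alpha>) - n"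
    using form by (simp add: form_def)
  then have "coeff (coeff (chart i (newton_dual F l)) (lookup (?\<alpha> - m) 2)) (lookup (?\<alpha> - m) i)
      = lookup (newton_dual F l) (?\<alpha> - m)"
    using coeff_chart[OF i form] by blast
  then have "coeff (coeff (chart i (newton_dual F l)) (lookup (?\<alpha> - m) 2)) 0 \<noteq> 0"
    using m by (simp add: lookup_minus lookup in_keys_iff)
  then have "\<not> [:0, 1:] dvd coeff (chart i (newton_dual F l)) (lookup (?\<alpha> - m) 2)"
    by (auto simp: dvd_def)
  then show ?thesis
    using that by (auto simp: const_poly_dvd_iff)
qed

lemma exponent_0_1:
  fixes a b :: nat
  shows "lookup (single (0::3) a + single 1 b) 0 = a" "lookup (single (0::3) a + single 1 b) 1 = b"
    "lookup (single (0::3) a + single 1 b) 2 = 0"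
  by (simp_all add: lookup_add lookup_single)

section \<open>The dual of a map of de Jonquieres shape\<close>

text \<open>
  The notation of the theorem. The two parts of the argument, on the degree and on the de
  Jonquieres property of the dual, share the bounds on the exponents that are proved here.
\<close>

locale jonquieres_forms =
  fixes d :: int and g h f0 f1 q f :: "'k::field pol3"
  assumes g: "form_xy (d - 1) g" and h: "form_xy (d - 2) h" and q: "q = g + var 2 * h"
    and f0: "form_xy d f0" and f1: "form_xy (d - 1) f1" and f: "f = f0 + var 2 * f1"
    and q_nonzero: "q \<noteq> 0"
begin

abbreviation "F \<equiv> triple (var 0 * q) (var 1 * q) f"

abbreviation "\<alpha> \<equiv> max_exponents F"

lemma z_free: "z_free g" "z_free h" "z_free f0" "z_free f1"
  using g h f0 f1 by (simp_all add: form_xy_iff)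

lemma keys_q: "keys q = keys g \<union> (+) (single 2 1) ` keys h"
  using z_free by (simp add: q keys_z_expansion)

lemma keys_f: "keys f = keys f0 \<union> (+) (single 2 1) ` keys f1"
  using z_free by (simp add: f keys_z_expansion)

lemma exponent_bound: "m \<in> keys (F j) \<Longrightarrow> lookup m i \<le> lookup \<alpha> i"
  using exponents_le_max_exponents[of F j] by (simp add: exponents_le_def)

lemma exponents_q:
  assumes "m \<in> keys q"
  shows "lookup m 0 + 1 \<le> lookup \<alpha> 0" "lookup m 1 + 1 \<le> lookup \<alpha> 1"
proof -
  have "single 0 1 + m \<in> keys (F 0)" "single 1 1 + m \<in> keys (F 1)"
    using assms by (simp_all add: keys_var_times)
  from exponent_bound[OF this(1), of 0] exponent_bound[OF this(2), of 1]
  show "lookup m 0 + 1 \<le> lookup \<alpha> 0" "lookup m 1 + 1 \<le> lookup \<alpha> 1"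
    by (simp_all add: lookup_add)
qed

lemma exponents_f:
  assumes "m \<in> keys f"
  shows "lookup m i \<le> lookup \<alpha> i"
  using exponent_bound[of m 2 i] assms by simp

lemma exponents_gh:
  assumes "m \<in> keys g \<union> keys h"
  shows "lookup m 0 + 1 \<le> lookup \<alpha> 0" "lookup m 1 + 1 \<le> lookup \<alpha> 1" "lookup m 2 = 0"
proof -
  have "m \<in> keys q \<or> single 2 1 + m \<in> keys q"
    using assms by (auto simp: keys_q)
  then show "lookup m 0 + 1 \<le> lookup \<alpha> 0" "lookup m 1 + 1 \<le> lookup \<alpha> 1"
    using exponents_q[of m] exponents_q[of "single 2 1 + m"]
    by (auto simp: lookup_add lookup_single)
  show "lookup m 2 = 0"
    using assms z_free by (auto simp: z_free_def)
qed

lemma exponents_f0f1: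
  assumes "m \<in> keys f0 \<union> keys f1"
  shows "lookup m 0 \<le> lookup \<alpha> 0" "lookup m 1 \<le> lookup \<alpha> 1" "lookup m 2 = 0"
proof -
  have "m \<in> keys f \<or> single 2 1 + m \<in> keys f"
    using assms by (auto simp: keys_f)
  then show "lookup m 0 \<le> lookup \<alpha> 0" "lookup m 1 \<le> lookup \<alpha> 1"
    using exponents_f[of m 0] exponents_f[of "single 2 1 + m" 0]
      exponents_f[of m 1] exponents_f[of "single 2 1 + m" 1]
    by (auto simp: lookup_add lookup_single)
  show "lookup m 2 = 0"
    using assms z_free by (auto simp: z_free_def)
qed

lemma F_nonzero: "F 0 \<noteq> 0"
  using q_nonzero by simp

text \<open>
  Of the two forms $xq$ and $yq$, the one with the additional factor has the greater exponent,
  which is why 1 is added at $g$ and $h$ for either variable.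
\<close>

lemma exponent_attained:
  assumes i: "i = 0 \<or> i = 1"
  shows "(\<exists>m \<in> keys g \<union> keys h. lookup \<alpha> i \<le> lookup m i + 1)
    \<or> (\<exists>m \<in> keys f0 \<union> keys f1. lookup \<alpha> i \<le> lookup m i)"
proof -
  obtain l m where m: "m \<in> keys (F l)" "lookup m i = lookup \<alpha> i"
    using max_exponent_attained[of F 0 i] F_nonzero by blast
  have q_case: ?thesis if "m' \<in> keys q" "lookup \<alpha> i \<le> lookup m' i + 1" for m'
    using that i by (auto simp: keys_q lookup_add lookup_single)
  show ?thesis
  proof (rule exhaust_3[of l])
    assume "l = 0"
    then obtain m' where "m' \<in> keys q" "m = single 0 1 + m'"
      using m by (auto simp: keys_var_times)
    then show ?thesis
      using q_case[of m'] m i by (auto simp: lookup_add lookup_single)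
  next
    assume "l = 1"
    then obtain m' where "m' \<in> keys q" "m = single 1 1 + m'"
      using m by (auto simp: keys_var_times)
    then show ?thesis
      using q_case[of m'] m i by (auto simp: lookup_add lookup_single)
  next
    assume "l = 2"
    then have "m \<in> keys f0 \<or> (\<exists>m'\<in>keys f1. m = single 2 1 + m')"
      using m by (auto simp: keys_f)
    then obtain m' where "m' \<in> keys f0 \<union> keys f1" "m = m' \<or> m = single 2 1 + m'"
      by blast
    then have "m' \<in> keys f0 \<union> keys f1" "lookup \<alpha> i \<le> lookup m' i"
      using i m by (auto simp: lookup_add lookup_single)
    then show ?thesis
      by blast
  qed
qed

lemma last_index_max:
  "Max {last_index p + c | p c. (p, c) \<in> {(g, 1), (h, 1), (f0, 0), (f1, 0)} \<and> p \<noteq> 0} = int (lookup \<alpha> 1)"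
    (is "Max ?S = _")
proof (rule Max_eqI)
  have "?S \<subseteq> (\<lambda>(p, c). last_index p + c) ` {(g, 1), (h, 1), (f0, 0), (f1, 0)}"
    by auto
  then show "finite ?S"
    by (rule finite_subset) simp
  have le: "s \<le> int (lookup \<alpha> 1)" if s: "s \<in> ?S" for s
  proof -
    from s obtain p c where pc: "(p, c) \<in> {(g, 1), (h, 1), (f0, 0), (f1, 0)}" "p \<noteq> 0" "s = last_index p + c"
      by blast
    then have "last_index p \<in> (\<lambda>m. int (lookup m 1)) ` keys p"
      unfolding last_index_def by (intro Max_in) auto
    then obtain m where "m \<in> keys p" "last_index p = int (lookup m 1)"
      by blast
    then show ?thesis
      using pc exponents_gh(2)[of m] exponents_f0f1(2)[of m] by auto
  qed
  then show "\<And>s. s \<in> ?S \<Longrightarrow> s \<le> int (lookup \<alpha> 1)" .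
  have mem: "int (lookup \<alpha> 1) \<in> ?S"
    if pc: "(p, c) \<in> {(g, 1), (h, 1), (f0, 0), (f1, 0)}" "m \<in> keys p" "int (lookup \<alpha> 1) \<le> int (lookup m 1) + c" for p c m
  proof -
    have "p \<noteq> 0" "int (lookup m 1) \<le> last_index p"
      using pc by (auto simp: last_index_def intro: Max_ge)
    then have S: "last_index p + c \<in> ?S"
      using pc by blast
    have "last_index p + c = int (lookup \<alpha> 1)"
      using le[OF S] \<open>int (lookup m 1) \<le> last_index p\<close> pc(3) by linarith
    then show ?thesis
      using S by simp
  qed
  from exponent_attained[of 1]
  consider m where "m \<in> keys g \<union> keys h" "lookup \<alpha> 1 \<le> lookup m 1 + 1"
    | m where "m \<in> keys f0 \<union> keys f1" "lookup \<alpha> 1 \<le> lookup m 1"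
    by blast
  then show "int (lookup \<alpha> 1) \<in> ?S"
  proof cases
    case (1 m)
    then show ?thesis
      using mem[of g 1 m] mem[of h 1 m] by auto
  next
    case (2 m)
    then show ?thesis
      using mem[of f0 0 m] mem[of f1 0 m] by auto
  qed
qed

lemma first_index_min:
  "Min {first_index p + c | p c. (p, c) \<in> {(g, 0), (h, 1), (f0, 0), (f1, 1)} \<and> p \<noteq> 0} = d - int (lookup \<alpha> 0)"
    (is "Min ?S = _")
proof (rule Min_eqI)
  have "?S \<subseteq> (\<lambda>(p, c). first_index p + c) ` {(g, 0), (h, 1), (f0, 0), (f1, 1)}"
    by auto
  then show "finite ?S"
    by (rule finite_subset) simp
  \<comment> \<open>The degree converts exponents of $y$ to exponents of $x$.\<close>
  have degrees: "m \<in> keys g \<Longrightarrow> int (lookup m 1) = d - 1 - int (lookup m 0)"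
    "m \<in> keys h \<Longrightarrow> int (lookup m 1) = d - 2 - int (lookup m 0)"
    "m \<in> keys f0 \<Longrightarrow> int (lookup m 1) = d - int (lookup m 0)"
    "m \<in> keys f1 \<Longrightarrow> int (lookup m 1) = d - 1 - int (lookup m 0)" for m
    using g h f0 f1 by (auto simp: form_xy_def form_def mdeg_3)
  have le: "d - int (lookup \<alpha> 0) \<le> s" if s: "s \<in> ?S" for s
  proof -
    from s obtain p c where pc: "(p, c) \<in> {(g, 0), (h, 1), (f0, 0), (f1, 1)}" "p \<noteq> 0" "s = first_index p + c"
      by blast
    then have "first_index p \<in> (\<lambda>m. int (lookup m 1)) ` keys p"
      unfolding first_index_def by (intro Min_in) auto
    then obtain m where "m \<in> keys p" "first_index p = int (lookup m 1)"
      by blast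
    then show ?thesis
      using pc exponents_gh(1)[of m] exponents_f0f1(1)[of m] degrees[of m] by auto
  qed
  then show "\<And>s. s \<in> ?S \<Longrightarrow> d - int (lookup \<alpha> 0) \<le> s" .
  have mem: "d - int (lookup \<alpha> 0) \<in> ?S"
    if pc: "(p, c) \<in> {(g, 0), (h, 1), (f0, 0), (f1, 1)}" "m \<in> keys p" "int (lookup m 1) + c \<le> d - int (lookup \<alpha> 0)" for p c m
  proof -
    have "p \<noteq> 0" "first_index p \<le> int (lookup m 1)"
      using pc by (auto simp: first_index_def intro: Min_le)
    then have S: "first_index p + c \<in> ?S"
      using pc by blast
    have "first_index p + c = d - int (lookup \<alpha> 0)"
      using le[OF S] \<open>first_index p \<le> int (lookup m 1)\<close> pc(3) by linarith
    then show ?thesis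
      using S by simp
  qed
  from exponent_attained[of 0]
  consider m where "m \<in> keys g \<union> keys h" "lookup \<alpha> 0 \<le> lookup m 0 + 1"
    | m where "m \<in> keys f0 \<union> keys f1" "lookup \<alpha> 0 \<le> lookup m 0"
    by blast
  then show "d - int (lookup \<alpha> 0) \<in> ?S"
  proof cases
    case (1 m)
    then show ?thesis
      using mem[of g 0 m] mem[of h 1 m] degrees[of m] by auto
  next
    case (2 m)
    then show ?thesis
      using mem[of f0 0 m] mem[of f1 1 m] degrees[of m] by auto
  qed
qed

text \<open>
  The vectors with respect to which the coefficients of $q$ and of $f$ are complemented: the
  maximal exponents without those of the factors $x, y, z$, respectively $z$, that are split
  off.
\<close>

definition \<beta> :: "3 \<Rightarrow>\<^sub>0 nat" where "\<beta> = single 0 (lookup \<alpha> 0 - 1) + single 1 (lookup \<alpha> 1 - 1)"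

definition \<gamma> :: "3 \<Rightarrow>\<^sub>0 nat" where "\<gamma> = single 0 (lookup \<alpha> 0) + single 1 (lookup \<alpha> 1)"

lemma lookup_\<beta>: "lookup \<beta> 0 = lookup \<alpha> 0 - 1" "lookup \<beta> 1 = lookup \<alpha> 1 - 1" "lookup \<beta> 2 = 0"
  by (simp_all add: \<beta>_def exponent_0_1)

lemma lookup_\<gamma>: "lookup \<gamma> 0 = lookup \<alpha> 0" "lookup \<gamma> 1 = lookup \<alpha> 1" "lookup \<gamma> 2 = 0"
  by (simp_all add: \<gamma>_def exponent_0_1)

text \<open>
  The coefficients of the dual, in the roles of $g, h, f_0, f_1$. A factor $z$ becomes $z^0$
  and conversely, hence the exchange.
\<close>

definition "g_dual = complement \<beta> h"
definition "h_dual = complement \<beta> g"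
definition "f0_dual = complement \<gamma> f1"
definition "f1_dual = complement \<gamma> f0"

lemma form_q: "form (d - 1) q"
  using form_z_expansion[of "d - 1" g h] g h by (simp add: q)

lemma form_f: "form d f"
  using form_z_expansion[of d f0 f1] f0 f1 by (simp add: f)

lemma d_positive: "d \<ge> 1"
proof -
  show ?thesis
    using form_q form_negative[of "d - 1" q] q_nonzero by force
qed

lemma alpha_positive: "lookup \<alpha> 0 \<ge> 1" "lookup \<alpha> 1 \<ge> 1"
proof -
  obtain m where "m \<in> keys q"
    using q_nonzero by (metis keys_eq_empty ex_in_conv)
  then show "lookup \<alpha> 0 \<ge> 1" "lookup \<alpha> 1 \<ge> 1"
    using exponents_q[of m] by simp_all
qed

lemma exponents_le_\<beta>: "exponents_le \<beta> g" "exponents_le \<beta> h"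
proof -
  have "lookup m i \<le> lookup \<beta> i" if "m \<in> keys g \<union> keys h" for m i
    using exponents_gh[OF that] by (cases rule: exhaust_3[of i]) (simp_all add: lookup_\<beta>)
  then show "exponents_le \<beta> g" "exponents_le \<beta> h"
    by (simp_all add: exponents_le_def)
qed

lemma exponents_le_\<gamma>: "exponents_le \<gamma> f0" "exponents_le \<gamma> f1"
proof -
  have "lookup m i \<le> lookup \<gamma> i" if "m \<in> keys f0 \<union> keys f1" for m i
    using exponents_f0f1[OF that] by (cases rule: exhaust_3[of i]) (simp_all add: lookup_\<gamma>)
  then show "exponents_le \<gamma> f0" "exponents_le \<gamma> f1"
    by (simp_all add: exponents_le_def)
qed

lemma newton_dual_eq:
  assumes z: "lookup \<alpha> 2 = 1"
  shows "newton_dual F = triple (var 1 * (g_dual + var 2 * h_dual)) (var 0 * (g_dual + var 2 * h_dual)) (f0_dual + var 2 * f1_dual)"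
proof -
  have \<alpha>_\<beta>: "\<alpha> = single 0 1 + single 1 1 + single 2 1 + \<beta>"
    by (rule exponent_eqI) (use alpha_positive z in \<open>simp_all add: lookup_add lookup_single lookup_\<beta>\<close>)
  have \<alpha>_\<gamma>: "\<alpha> = single 2 1 + \<gamma>"
    by (rule exponent_eqI) (use z in \<open>simp_all add: lookup_add lookup_single lookup_\<gamma>\<close>)
  note shift_\<beta> = complement_single_times[OF _ trans[OF \<alpha>_\<beta>]]
    and shift_\<gamma> = complement_single_times[OF _ trans[OF \<alpha>_\<gamma>]]
  have xg: "complement \<alpha> (single (single 0 1) 1 * g) = single (single 1 1 + single 2 1) 1 * h_dual"
    and xh: "complement \<alpha> (single (single 0 1 + single 2 1) 1 * h) = single (single 1 1) 1 * g_dual"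
    and yg: "complement \<alpha> (single (single 1 1) 1 * g) = single (single 0 1 + single 2 1) 1 * h_dual"
    and yh: "complement \<alpha> (single (single 1 1 + single 2 1) 1 * h) = single (single 0 1) 1 * g_dual"
    unfolding g_dual_def h_dual_def
    by (rule shift_\<beta>, simp add: exponents_le_\<beta>, simp add: ac_simps)+
  \<comment> \<open>Here \<open>single 0 1\<close> is the constant polynomial 1, as a monomial factor.\<close>
  have f0: "complement \<alpha> (single 0 1 * f0) = single (single 2 1) 1 * f1_dual"
    and f1: "complement \<alpha> (single (single 2 1) 1 * f1) = single 0 1 * f0_dual"
    unfolding f0_dual_def f1_dual_def
    by (rule shift_\<gamma>, simp add: exponents_le_\<gamma>, simp)+
  note xg = xg[folded var_times_var, folded var_def] and xh = xh[folded var_times_var, folded var_def]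
    and yg = yg[folded var_times_var, folded var_def] and yh = yh[folded var_times_var, folded var_def]
    and f0 = f0[folded var_def] and f1 = f1[folded var_def]
  have "newton_dual F i = triple (var 1 * (g_dual + var 2 * h_dual)) (var 0 * (g_dual + var 2 * h_dual)) (f0_dual + var 2 * f1_dual) i" for i
  proof (rule exhaust_3[of i])
    assume "i = 0"
    then show ?thesis
      using xg xh by (simp add: newton_dual_eq_complement q distrib_left complement_add mult.assoc)
  next
    assume "i = 1"
    then show ?thesis
      using yg yh by (simp add: newton_dual_eq_complement q distrib_left complement_add mult.assoc)
  next
    assume "i = 2"
    then show ?thesis
      using f0 f1 by (simp add: newton_dual_eq_complement f complement_add)
  qed
  then show ?thesis
    by blast
qed

definition "d_dual = int (lookup \<alpha> 0) + int (lookup \<alpha> 1) + 1 - d"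

lemma dual_forms: "form_xy (d_dual - 1) g_dual" "form_xy (d_dual - 2) h_dual" "form_xy d_dual f0_dual" "form_xy (d_dual - 1) f1_dual"
proof -
  have "int (mdeg \<beta>) = int (lookup \<alpha> 0) + int (lookup \<alpha> 1) - 2"
    "int (mdeg \<gamma>) = int (lookup \<alpha> 0) + int (lookup \<alpha> 1)"
    using alpha_positive by (simp_all add: mdeg_3 lookup_\<beta> lookup_\<gamma>)
  then have deg: "d_dual - 1 = int (mdeg \<beta>) - (d - 2)" "d_dual - 2 = int (mdeg \<beta>) - (d - 1)"
    "d_dual = int (mdeg \<gamma>) - (d - 1)" "int (mdeg \<gamma>) - (d - 1) - 1 = int (mdeg \<gamma>) - d"
    by (simp_all add: d_dual_def)
  show "form_xy (d_dual - 1) g_dual" "form_xy (d_dual - 2) h_dual"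
    unfolding deg(1,2) using g h
    by (simp_all add: form_xy_iff g_dual_def h_dual_def form_complement exponents_le_\<beta> z_free_complement lookup_\<beta>)
  show "form_xy d_dual f0_dual" "form_xy (d_dual - 1) f1_dual"
    unfolding deg(3,4) using f0 f1
    by (simp_all add: form_xy_iff f0_dual_def f1_dual_def form_complement exponents_le_\<gamma> z_free_complement lookup_\<gamma>)
qed

lemma dual_degree_positive: "d_dual \<ge> 1"
proof -
  obtain m where m: "m \<in> keys q"
    using q_nonzero by (metis keys_eq_empty ex_in_conv)
  have "d - 1 = int (lookup m 0) + int (lookup m 1) + int (lookup m 2)"
    using m form_q by (auto simp: form_def mdeg_3)
  moreover have "lookup m 2 \<le> 1"
    using m z_free by (auto simp: keys_q z_free_def lookup_add)
  ultimately show ?thesis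
    using exponents_q[OF m] by (simp add: d_dual_def)
qed

text \<open>
  Complementing inverts $y/x$, and so does the change from the chart $x = 1$ to the chart $y =
  1$, so the same polynomials in $t$ appear on both sides. The forms $h$ and $f_1$ have degree
  one less than $g$ and $f_0$, which leads to the factor $t$.
\<close>

lemma dual_charts:
  defines "t \<equiv> [:0, 1 :: 'k:]"
  shows "line_chart 0 h_dual * t ^ nat d = t ^ lookup \<alpha> 0 * line_chart 1 g"
    and "line_chart 0 g_dual * t ^ nat d = t ^ lookup \<alpha> 0 * (t * line_chart 1 h)"
    and "line_chart 0 f1_dual * t ^ nat d = t ^ lookup \<alpha> 0 * line_chart 1 f0"
    and "line_chart 0 f0_dual * t ^ nat d = t ^ lookup \<alpha> 0 * (t * line_chart 1 f1)"
proof -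
  obtain n where d: "d = int n + 1"
    using d_positive by (metis add.commute zle_iff_zadd)
  then have n: "nat d = Suc n"
    by simp
  obtain a where a: "lookup \<alpha> 0 = Suc a"
    using alpha_positive by (metis Suc_le_D One_nat_def)
  have "form_xy (int n) g" "form_xy (int n) f1"
    using g f1 d by simp_all
  have "line_chart 0 h_dual * t ^ n = t ^ a * line_chart 1 g"
    using line_chart_complement[OF \<open>form_xy (int n) g\<close> exponents_le_\<beta>(1)]
    by (simp add: h_dual_def lookup_\<beta> t_def a)
  then have "t * (line_chart 0 h_dual * t ^ n) = t * (t ^ a * line_chart 1 g)"
    by (rule arg_cong)
  then show "line_chart 0 h_dual * t ^ nat d = t ^ lookup \<alpha> 0 * line_chart 1 g"
    unfolding n a by (simp only: power_Suc mult_ac)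
  show "line_chart 0 g_dual * t ^ nat d = t ^ lookup \<alpha> 0 * (t * line_chart 1 h)"
  proof (cases n)
    case 0
    then have "h = 0"
      using form_negative[of "d - 2" h] h d by (simp add: form_xy_iff)
    then have "g_dual = 0"
      unfolding g_dual_def by (simp only: complement_zero)
    then show ?thesis
      using \<open>h = 0\<close> by (simp only: line_chart_zero mult_zero_left mult_zero_right)
  next
    case (Suc k)
    then have "form_xy (int k) h"
      using h d by simp
    then have "line_chart 0 g_dual * t ^ k = t ^ a * line_chart 1 h"
      using line_chart_complement[of k h \<beta>] exponents_le_\<beta> by (simp add: g_dual_def lookup_\<beta> t_def a)
    then have "t * (t * (line_chart 0 g_dual * t ^ k)) = t * (t * (t ^ a * line_chart 1 h))"
      by (rule arg_cong)
    then show ?thesis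
      unfolding n a Suc by (simp only: power_Suc mult_ac)
  qed
  show "line_chart 0 f1_dual * t ^ nat d = t ^ lookup \<alpha> 0 * line_chart 1 f0"
    using line_chart_complement[of "nat d" f0 \<gamma>] f0 exponents_le_\<gamma> d_positive
    by (simp add: f1_dual_def lookup_\<gamma> t_def)
  have "line_chart 0 f0_dual * t ^ n = t ^ lookup \<alpha> 0 * line_chart 1 f1"
    using line_chart_complement[OF \<open>form_xy (int n) f1\<close> exponents_le_\<gamma>(2)]
    by (simp add: f0_dual_def lookup_\<gamma> t_def)
  then have "t * (line_chart 0 f0_dual * t ^ n) = t * (t ^ lookup \<alpha> 0 * line_chart 1 f1)"
    by (rule arg_cong)
  then show "line_chart 0 f0_dual * t ^ nat d = t ^ lookup \<alpha> 0 * (t * line_chart 1 f1)"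
    unfolding n by (simp only: power_Suc mult_ac)
qed

lemma dual_determinant:
  assumes "g * f1 \<noteq> f0 * h"
  shows "line_chart 0 g_dual * line_chart 0 f1_dual \<noteq> line_chart 0 f0_dual * line_chart 0 h_dual"
proof
  let ?t = "[:0, 1 :: 'k:]"
  assume eq: "line_chart 0 g_dual * line_chart 0 f1_dual = line_chart 0 f0_dual * line_chart 0 h_dual"
  have "(line_chart 0 g_dual * ?t ^ nat d) * (line_chart 0 f1_dual * ?t ^ nat d)
      = (line_chart 0 g_dual * line_chart 0 f1_dual) * (?t ^ nat d * ?t ^ nat d)"
    by (simp only: mult_ac)
  also have "\<dots> = (line_chart 0 f0_dual * ?t ^ nat d) * (line_chart 0 h_dual * ?t ^ nat d)"
    unfolding eq by (simp only: mult_ac)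
  finally have "(?t ^ lookup \<alpha> 0 * ?t ^ lookup \<alpha> 0 * ?t) * (line_chart 1 f0 * line_chart 1 h)
      = (?t ^ lookup \<alpha> 0 * ?t ^ lookup \<alpha> 0 * ?t) * (line_chart 1 g * line_chart 1 f1)"
    unfolding dual_charts by (simp only: mult_ac)
  then have "line_chart 1 f0 * line_chart 1 h = line_chart 1 g * line_chart 1 f1"
    by (subst (asm) mult_left_cancel) simp_all
  then have "line_chart 1 (g * f1 - f0 * h) = 0"
    by (simp add: line_chart_hom)
  moreover have "form_xy (2 * d - 2) (g * f1 - f0 * h)"
    using form_xy_mult[OF g f1] form_xy_mult[OF f0 h] by (simp add: form_xy_diff)
  ultimately show False
    using line_chart_eq_0[of 1] assms by fastforce
qed

lemma dual_not_dvd: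
  assumes z: "lookup \<alpha> 2 = 1" and i: "i = 0 \<or> i = 1"
  shows "\<not> ([:[:0, 1:]:] dvd chart i (g_dual + var 2 * h_dual) \<and> [:[:0, 1:]:] dvd chart i (f0_dual + var 2 * f1_dual))"
proof
  assume dvd: "[:[:0, 1:]:] dvd chart i (g_dual + var 2 * h_dual) \<and> [:[:0, 1:]:] dvd chart i (f0_dual + var 2 * f1_dual)"
  have forms: "form d (F j)" for j
    using form_f form_mult[OF form_var form_q] by (simp add: triple_def)
  obtain l where "\<not> [:[:0, 1:]:] dvd chart i (newton_dual F l)"
    by (rule newton_dual_not_dvd[of i d F 0, OF i forms F_nonzero])
  moreover have "[:[:0, 1:]:] dvd chart i (newton_dual F l)"
    unfolding newton_dual_eq[OF z] using dvd by (simp add: triple_def chart_hom dvd_mult)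
  ultimately show False
    by contradiction
qed

text \<open>
  A prime $\pi$ of $k[t]$ that divides all four coefficients is either $t$, which contradicts
  that the maximal exponent of $x$ is attained, or it divides the original coefficients by
  \<open>dual_charts\<close>. In the latter case its homogenization is a common factor of $xq,
  yq, f$.
\<close>

lemma dual_affine_coprime:
  assumes z: "lookup \<alpha> 2 = 1" and det: "g * f1 \<noteq> f0 * h"
    and gcd: "\<And>p. (\<forall>i. p dvd F i) \<Longrightarrow> p dvd 1"
    and p: "p dvd line_chart 0 g_dual" "p dvd line_chart 0 h_dual" "p dvd line_chart 0 f0_dual" "p dvd line_chart 0 f1_dual"
  shows "p dvd 1"
proof (rule ccontr)
  let ?t = "[:0, 1 :: 'k:]"
  assume nonunit: "\<not> p dvd 1"
  have "p \<noteq> 0"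
    using p dual_determinant[OF det] by auto
  then obtain \<pi> where \<pi>: "irreducible \<pi>" "\<pi> dvd p"
    using irreducible_factor nonunit by blast
  then have prime: "prime_elem \<pi>"
    by (simp add: field_poly_irreducible_imp_prime)
  have dvd: "\<pi> dvd line_chart 0 g_dual" "\<pi> dvd line_chart 0 h_dual" "\<pi> dvd line_chart 0 f0_dual" "\<pi> dvd line_chart 0 f1_dual"
    using \<pi>(2) p dvd_trans by blast+
  show False
  proof (cases "\<pi> dvd ?t")
    case True
    then obtain w where w: "?t = \<pi> * w"
      by blast
    have "irreducible ?t"
      by (rule irreducible_linear_field_poly) simp
    then have "w dvd 1"
      using w \<pi>(1) irreducibleD irreducible_not_unit by blast
    then have "?t dvd \<pi>"
      unfolding w by (simp add: mult_unit_dvd_iff)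
    then have "?t dvd line_chart 0 g_dual" "?t dvd line_chart 0 h_dual" "?t dvd line_chart 0 f0_dual" "?t dvd line_chart 0 f1_dual"
      using dvd dvd_trans by blast+
    then show False
      using dual_not_dvd[OF z, of 0] dual_forms
      by (simp add: chart_z_expansion form_xy_iff const_poly_dvd_linear)
  next
    case False
    have cancel: "\<pi> dvd Y" if "\<pi> dvd X" "X * ?t ^ nat d = ?t ^ lookup \<alpha> 0 * Y" for X Y
    proof -
      have "\<pi> dvd ?t ^ lookup \<alpha> 0 * Y"
        using that by (metis dvd_mult2)
      then show ?thesis
        using prime False by (metis prime_elem_dvd_mult_iff prime_elem_dvd_power)
    qed
    have cancel1: "\<pi> dvd Y" if "\<pi> dvd ?t * Y" for Y
      using that prime False prime_elem_dvd_mult_iff by blast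
    have dvd1: "\<pi> dvd line_chart 1 g" "\<pi> dvd line_chart 1 h" "\<pi> dvd line_chart 1 f0" "\<pi> dvd line_chart 1 f1"
      using cancel[OF dvd(2) dual_charts(1)] cancel[OF dvd(1) dual_charts(2)]
        cancel[OF dvd(4) dual_charts(3)] cancel[OF dvd(3) dual_charts(4)] cancel1 by blast+
    let ?P = "homogenize (degree \<pi>) \<pi>"
    have hom: "?P dvd r" if "form_xy e r" "\<pi> dvd line_chart 1 r" for e r
    proof (cases "e < 0")
      case True
      then show ?thesis
        using form_negative[of e r] that by (simp add: form_xy_iff)
    next
      case False
      then have "form_xy (int (nat e)) r"
        using that by simp
      moreover have "\<pi> \<noteq> 0"
        using \<pi>(1) by auto
      ultimately show ?thesis
        using homogenize_dvd that(2) by blast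
    qed
    have "?P dvd q" "?P dvd f"
      unfolding q f using hom[OF g] hom[OF h] hom[OF f0] hom[OF f1] dvd1
      by (simp_all add: dvd_add dvd_mult)
    then have "?P dvd 1"
      by (intro gcd) (simp add: triple_def dvd_mult)
    then have "line_chart 1 ?P dvd line_chart 1 1"
      by (rule line_chart_dvd)
    then show False
      using \<pi>(1) by (simp add: line_chart_homogenize line_chart_hom irreducible_def)
  qed
qed

lemma max_exponent_z:
  assumes "\<And>i. \<exists>j. \<exists>m\<in>keys (F j). lookup m i \<noteq> 0"
  shows "lookup \<alpha> 2 = 1"
proof -
  obtain j m where m: "m \<in> keys (F j)" "lookup m 2 \<noteq> 0"
    using assms by blast
  then have "lookup \<alpha> 2 \<ge> 1"
    using exponent_bound[of m j 2] by simp
  moreover have "lookup \<alpha> 2 \<le> 1"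
  proof -
    obtain l m where m: "m \<in> keys (F l)" "lookup m 2 = lookup \<alpha> 2"
      using max_exponent_attained[of F 0 2] F_nonzero by blast
    have "lookup m' 2 \<le> 1" if "m' \<in> keys q \<union> keys f" for m'
      using that z_free by (auto simp: keys_q keys_f z_free_def lookup_add)
    then have "lookup m 2 \<le> 1"
      using m(1) by (cases rule: exhaust_3[of l]) (auto simp: keys_var_times lookup_add lookup_single)
    then show ?thesis
      using m(2) by simp
  qed
  ultimately show ?thesis
    by simp
qed

lemma de_jonquieres_newton_dual:
  assumes inf: "infinite (UNIV :: 'k set)" and "de_jonquieres d F"
  shows "de_jonquieres d_dual (newton_dual F)"
proof -
  have gcd: "\<And>p. (\<forall>i. p dvd F i) \<Longrightarrow> p dvd 1"
    and "\<And>i. \<exists>j. \<exists>m\<in>keys (F j). lookup m i \<noteq> 0" and "cremona F"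
    using assms(2) unfolding de_jonquieres_def canonical_restrictions_def by blast+
  then have z: "lookup \<alpha> 2 = 1" and det: "g * f1 \<noteq> f0 * h"
    using max_exponent_z determinant_if_cremona[OF z_free q q_nonzero f] by blast+
  have det': "g_dual * f1_dual \<noteq> f0_dual * h_dual"
    using dual_determinant[OF det] by (metis line_chart_hom(4))
  show ?thesis
    unfolding newton_dual_eq[OF z]
    by (rule de_jonquieres_criterion[OF inf dual_degree_positive dual_forms(1,2) refl dual_forms(3,4) refl det'])
       (use dual_affine_coprime[OF z det gcd] dual_not_dvd[OF z, of 1] in blast)+
qed

end

theorem proposition1p13:
  fixes q f g h f0 f1 :: "'k::field pol3" and d :: int
  assumes "infinite (UNIV :: 'k set)"
    and "form_xy (d - 1) g" and "form_xy (d - 2) h" and "q = g + var 2 * h"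
    and "form_xy d f0" and "form_xy (d - 1) f1" and "f = f0 + var 2 * f1"
    and "q \<noteq> 0" and "f \<noteq> 0"
    and "de_jonquieres d (triple (var 0 * q) (var 1 * q) f)"
  shows "de_jonquieres
     (Max {last_index p + c | p c. (p, c) \<in> {(g, 1), (h, 1), (f0, 0), (f1, 0)} \<and> p \<noteq> 0}
      - Min {first_index p + c | p c. (p, c) \<in> {(g, 0), (h, 1), (f0, 0), (f1, 1)} \<and> p \<noteq> 0}
      + 1)
     (newton_dual (triple (var 0 * q) (var 1 * q) f))"
proof -
  interpret jonquieres_forms d g h f0 f1 q f
    by unfold_locales (fact assms)+
  show ?thesis
    unfolding last_index_max first_index_min
    using de_jonquieres_newton_dual[OF assms(1) assms(10)] by (simp add: d_dual_def algebra_simps)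
qed

end
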